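(* Fix a finite graph $(V,E)$ (no self-loops) with $V=V_\partial\sqcup V_b$ and a partition $V_\partial=A\sqcup B\sqcup C$, and suppose the minimal tripartition $V=\Gamma_A\sqcup\Gamma_B\sqcup\Gamma_C$ for $A,B,C$ is unique, with edge set $\gamma_{ABC}$. Let $\ket\Psi$ be the random tensor network state with bond dimension $D$ on this graph. Then, with $\pi^{(1)}=(12)(34)$, $\pi^{(2)}=(13)(24)$, $\pi^{(3)}=(14)(23)$, $$\mathbb E\,\bra\Psi^{\otimes4}\big(\pi^{(1)}_A\otimes\pi^{(2)}_B\otimes\pi^{(3)}_C\big)\ket\Psi^{\otimes4}=D^{-2|\gamma_{ABC}|}\big(1+\mathcal O(D^{-1})\big)$$ as $D\to\infty$ with the graph fixed.
   Context: Random tensor network state: for each edge $e=(vw)\in E$ let $\mathcal H_{e,v}=\mathcal H_{e,w}=\mathbb C^D$ and $\ket{\phi_e}=D^{-1/2}\sum_{i=1}^D\ket{ii}\in\mathcal H_{e,v}\otimes\mathcal H_{e,w}$. For a vertex $v$ let $\mathcal H_v=\bigotimes_{e\ni v}\mathcal H_{e,v}$, of dimension $D^{\deg(v)}$. For each bulk vertex $v\in V_b$ let $\ket{\psi_v}\in\mathcal H_v$ be an independent Haar-random unit vector, and set $\ket\Psi=\big(I_{V_\partial}\otimes\bigotimes_{v\in V_b}D^{\deg(v)/2}\bra{\psi_v}\big)\bigotimes_{e\in E}\ket{\phi_e}\in\bigotimes_{v\in V_\partial}\mathcal H_v$ (normalized only in expectation). For $X\subseteq V_\partial$, $\mathcal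 H_X=\bigotimes_{v\in X}\mathcal H_v$, and for $\pi\in S_4$, $\pi_X$ permutes the 4 copies of $\mathcal H_X$ in $(\bigotimes_{v\in V_\partial}\mathcal H_v)^{\otimes4}$ according to $\pi$, acting trivially on the rest. A tripartition for $A,B,C$ is a partition $V=\Gamma_A\sqcup\Gamma_B\sqcup\Gamma_C$ with $V_\partial\cap\Gamma_A=A$, $V_\partial\cap\Gamma_B=B$, $V_\partial\cap\Gamma_C=C$; its edge set $\gamma_{ABC}$ consists of the edges with endpoints in different parts; it is minimal if $|\gamma_{ABC}|$ is minimal among all tripartitions. *)

theory Defs
  imports "HOL-Probability.Probability" "HOL-Library.Landau_Symbols"
begin

text \<open>A finite (multi)graph without self-loops: a finite edge set E of an
  abstract edge type, each edge having a two-element set of endpoints.\<close>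

definition incident :: "'e set \<Rightarrow> ('e \<Rightarrow> 'v set) \<Rightarrow> 'v \<Rightarrow> 'e set" where
  "incident E ends v = {e \<in> E. v \<in> ends e}"

definition deg :: "'e set \<Rightarrow> ('e \<Rightarrow> 'v set) \<Rightarrow> 'v \<Rightarrow> nat" where
  "deg E ends v = card (incident E ends v)"

text \<open>Computational basis of H_v = tensor over incident edges of C^D:
  labellings of the incident edges by 0..D-1.\<close>
definition labels :: "'e set \<Rightarrow> ('e \<Rightarrow> 'v set) \<Rightarrow> nat \<Rightarrow> 'v \<Rightarrow> ('e \<Rightarrow> nat) set" where
  "labels E ends D v = (incident E ends v) \<rightarrow>\<^sub>E {..<D}"

text \<open>Basis of the boundary Hilbert space (tensor of H_v over boundary vertices).\<close>
definition bbasis :: "'e set \<Rightarrow> ('e \<Rightarrow> 'v set) \<Rightarrow> nat \<Rightarrow> 'v set \<Rightarrow> ('v \<Rightarrow> 'e \<Rightarrow> nat) set" where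
  "bbasis E ends D Vp = Pi\<^sub>E Vp (labels E ends D)"

definition cgauss :: "complex measure" where
  "cgauss = density lborel (\<lambda>z. ennreal (exp (- (cmod z)\<^sup>2) / pi))"

text \<open>Haar (unitarily invariant, uniform) probability measure on the unit sphere
  of C^I (I finite), realised as the law of a normalised standard complex
  Gaussian vector.\<close>
definition haar_sphere :: "'i set \<Rightarrow> ('i \<Rightarrow> complex) measure" where
  "haar_sphere I =
     distr (PiM I (\<lambda>_. cgauss)) (PiM I (\<lambda>_. borel))
       (\<lambda>z. restrict (\<lambda>i. z i / complex_of_real (sqrt (\<Sum>j\<in>I. (cmod (z j))\<^sup>2))) I)"

definition bulk_measure :: "'e set \<Rightarrow> ('e \<Rightarrow> 'v set) \<Rightarrow> nat \<Rightarrow> 'v set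
      \<Rightarrow> ('v \<Rightarrow> ('e \<Rightarrow> nat) \<Rightarrow> complex) measure" where
  "bulk_measure E ends D Vb = PiM Vb (\<lambda>v. haar_sphere (labels E ends D v))"

text \<open>Coefficient of Psi at the boundary basis vector x, given bulk vectors psi.
  The edge states phi_e force equal labels on the two half-edges of e
  (weight D^(-1/2) each); the bulk bras contribute
  D^(deg v / 2) * conj(psi_v(labels at v)).\<close>
definition rtn_state :: "'e set \<Rightarrow> ('e \<Rightarrow> 'v set) \<Rightarrow> 'v set \<Rightarrow> 'v set \<Rightarrow> nat
      \<Rightarrow> ('v \<Rightarrow> ('e \<Rightarrow> nat) \<Rightarrow> complex) \<Rightarrow> ('v \<Rightarrow> 'e \<Rightarrow> nat) \<Rightarrow> complex" where
  "rtn_state E ends Vp Vb D psi x =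
     (\<Sum>l \<in> E \<rightarrow>\<^sub>E {..<D}.
        (if (\<forall>v\<in>Vp. \<forall>e\<in>incident E ends v. l e = x v e) then 1 else 0)
        * complex_of_real (real D powr (- real (card E) / 2))
        * (\<Prod>v\<in>Vb. complex_of_real (real D powr (real (deg E ends v) / 2))
                     * cnj (psi v (restrict l (incident E ends v)))))"

definition pi1 :: "nat \<Rightarrow> nat" where "pi1 k = [1,0,3,2] ! k"
definition pi2 :: "nat \<Rightarrow> nat" where "pi2 k = [2,3,0,1] ! k"
definition pi3 :: "nat \<Rightarrow> nat" where "pi3 k = [3,2,1,0] ! k"

text \<open>Action of pi1_A (x) pi2_B (x) pi3_C on a basis vector y_0..y_3 of the
  4-fold tensor power (copies indexed 0..3).  All three permutations are
  involutions, so the direction convention is immaterial.\<close>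
definition twist :: "'v set \<Rightarrow> 'v set \<Rightarrow> 'v set \<Rightarrow> (nat \<Rightarrow> 'v \<Rightarrow> 'e \<Rightarrow> nat)
      \<Rightarrow> nat \<Rightarrow> 'v \<Rightarrow> 'e \<Rightarrow> nat" where
  "twist A B C y k = (\<lambda>v. if v \<in> A then y (pi1 k) v
                          else if v \<in> B then y (pi2 k) v
                          else if v \<in> C then y (pi3 k) v
                          else y k v)"

definition swap_moment :: "'e set \<Rightarrow> ('e \<Rightarrow> 'v set) \<Rightarrow> 'v set \<Rightarrow> 'v set \<Rightarrow> 'v set \<Rightarrow> 'v set
      \<Rightarrow> nat \<Rightarrow> ('v \<Rightarrow> ('e \<Rightarrow> nat) \<Rightarrow> complex) \<Rightarrow> complex" where
  "swap_moment E ends Vb A B C D psi =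
     (\<Sum>y \<in> {..<4::nat} \<rightarrow>\<^sub>E bbasis E ends D (A \<union> B \<union> C).
        cnj (\<Prod>k<4. rtn_state E ends (A \<union> B \<union> C) Vb D psi (twist A B C y k))
        * (\<Prod>k<4. rtn_state E ends (A \<union> B \<union> C) Vb D psi (y k)))"

definition expected_swap :: "'e set \<Rightarrow> ('e \<Rightarrow> 'v set) \<Rightarrow> 'v set \<Rightarrow> 'v set \<Rightarrow> 'v set \<Rightarrow> 'v set
      \<Rightarrow> nat \<Rightarrow> complex" where
  "expected_swap E ends Vb A B C D =
     integral\<^sup>L (bulk_measure E ends D Vb) (swap_moment E ends Vb A B C D)"

definition is_tripartition :: "'v set \<Rightarrow> 'v set \<Rightarrow> 'v set \<Rightarrow> 'v set \<Rightarrow> 'v set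
      \<Rightarrow> 'v set \<times> 'v set \<times> 'v set \<Rightarrow> bool" where
  "is_tripartition V Vp A B C t = (case t of (GA, GB, GC) \<Rightarrow>
      GA \<union> GB \<union> GC = V \<and> GA \<inter> GB = {} \<and> GA \<inter> GC = {} \<and> GB \<inter> GC = {}
      \<and> Vp \<inter> GA = A \<and> Vp \<inter> GB = B \<and> Vp \<inter> GC = C)"

definition cut_edges :: "'e set \<Rightarrow> ('e \<Rightarrow> 'v set) \<Rightarrow> 'v set \<times> 'v set \<times> 'v set \<Rightarrow> 'e set" where
  "cut_edges E ends t = (case t of (GA, GB, GC) \<Rightarrow>
      {e \<in> E. \<not> (ends e \<subseteq> GA \<or> ends e \<subseteq> GB \<or> ends e \<subseteq> GC)})"

definition is_min_tripartition :: "'v set \<Rightarrow> 'e set \<Rightarrow> ('e \<Rightarrow> 'v set) \<Rightarrow> 'v set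
      \<Rightarrow> 'v set \<Rightarrow> 'v set \<Rightarrow> 'v set \<Rightarrow> 'v set \<times> 'v set \<times> 'v set \<Rightarrow> bool" where
  "is_min_tripartition V E ends Vp A B C t =
     (is_tripartition V Vp A B C t \<and>
      (\<forall>t'. is_tripartition V Vp A B C t' \<longrightarrow> card (cut_edges E ends t) \<le> card (cut_edges E ends t')))"

end

theory Submission
  imports Defs
begin

text \<open>Averaging each bulk tensor over four replicas replaces it by a normalised sum over \<open>S\<^sub>4\<close>, so
  the expectation becomes a partition function of \<open>S\<^sub>4\<close>-valued spins on the vertices, the boundary
  spins being the three fixed-point-free involutions. An edge carrying spins \<open>p\<close>, \<open>q\<close> has weight \<open>D\<close>
  to the power of minus their Cayley distance. There are two colourings of \<open>S\<^sub>4\<close> by \<open>{1, 2, 3}\<close>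
  such that at most that many of them separate \<open>p\<close> from \<open>q\<close>, and such that they agree exactly
  on the three boundary spins. Hence a spin configuration costs at least the sum of the sizes of two
  tripartition cuts, and by uniqueness of the minimal tripartition only one configuration attains
  twice the minimum.\<close>

subsection \<open>Moments of the complex Gaussian and of the Haar measure\<close>

text \<open>The obstacle is that spin configurations are richer than tripartitions. A 4-cycle is one
  transposition away from two of the three boundary spins and so lies midway on a geodesic between
  them; a domain wall of cost 2 per edge can thus split into two walls of cost 1 each. One colouring
  cannot account for such split walls. With two colourings each half of a split wall is charged to
  one of them, and since they disagree on every spin other than the three boundary ones, a minimal
  configuration that uses an intermediate spin would yield two different minimal tripartitions. On
  the analytic side, representation theory of the unitary group is avoided: Haar moments of a given
  degree are proportional to Gaussian moments, and those count permutations by Wick's rule. Only the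
  leading behaviour of the constant matters, so crude counts of fixed points suffice in place of
  exact Haar integrals.\<close>

lemma lborel_complex:
  "(lborel :: complex measure) = distr (lborel \<Otimes>\<^sub>M lborel) borel (\<lambda>(x, y). Complex x y)"
proof (rule lborel_eqI)
  have m: "(\<lambda>(x, y). Complex x y) \<in> borel_measurable (lborel \<Otimes>\<^sub>M lborel)"
    unfolding Complex_eq by measurable
  fix l u :: complex
  assume "\<And>b. b \<in> Basis \<Longrightarrow> l \<bullet> b \<le> u \<bullet> b"
  from this[of 1] this[of \<i>] have le: "Re l \<le> Re u" "Im l \<le> Im u"
    by (auto simp: Basis_complex_def)
  have "(\<lambda>(x, y). Complex x y) -` box l u \<inter> space (lborel \<Otimes>\<^sub>M lborel)
      = {Re l<..<Re u} \<times> {Im l<..<Im u}"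
    by (auto simp: in_box_complex_iff space_pair_measure)
  then show "emeasure (distr (lborel \<Otimes>\<^sub>M lborel) borel (\<lambda>(x, y). Complex x y)) (box l u)
      = ennreal (\<Prod>b\<in>Basis. (u - l) \<bullet> b)"
    using le by (simp add: emeasure_distr[OF m] lborel.emeasure_pair_measure_Times
        Basis_complex_def ennreal_mult)
qed simp

text \<open>Moments of the centred real normal law of variance 1/2, the law of \<open>Re z\<close>
  and of \<open>Im z\<close> under \<open>cgauss\<close>. For n = 2k the value is
  (2k-1)!!/2^k.\<close>

definition normal_half_moment :: "nat \<Rightarrow> real" where
  "normal_half_moment n = (if even n then fact n / (4 ^ (n div 2) * fact (n div 2)) else 0)"

lemma normal_half_moment_Suc_0 [simp]: "normal_half_moment (Suc 0) = 0"
  by (simp add: normal_half_moment_def)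

text \<open>One-dimensional integration by parts in closed form; it starts the induction behind the
  complex version.\<close>

lemma normal_half_moment_Suc_Suc:
  "normal_half_moment (Suc (Suc n)) = real (Suc n) / 2 * normal_half_moment n"
proof (cases "even n")
  case True
  then obtain k where "n = 2 * k" by blast
  moreover have "1 + real k \<noteq> 0" by linarith
  ultimately show ?thesis by (simp add: normal_half_moment_def divide_simps)
qed (simp add: normal_half_moment_def)

lemma has_bochner_integral_normal_half_moment:
  "has_bochner_integral lborel (\<lambda>x. exp (- x\<^sup>2) / sqrt pi * x ^ n) (normal_half_moment n)"
proof -
  have s: "normal_density 0 (sqrt (1/2)) x = exp (- x\<^sup>2) / sqrt pi" for x
    by (simp add: normal_density_def)
  show ?thesis
  proof (cases "even n")
    case True
    then obtain k where "n = 2 * k" by blast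
    then show ?thesis
      using normal_moment_even[of "sqrt (1/2)" 0 k]
      by (simp add: s normal_half_moment_def)
  next
    case False
    then obtain k where "n = 2 * k + 1" using oddE by blast
    then show ?thesis
      using normal_moment_odd[of "sqrt (1/2)" 0 k]
      by (simp add: s normal_half_moment_def)
  qed
qed

lemma sets_cgauss [measurable_cong]: "sets cgauss = sets borel"
  by (simp add: cgauss_def)

lemma has_bochner_integral_cgauss_Re_Im:
  "has_bochner_integral cgauss (\<lambda>z. Re z ^ p * Im z ^ q) (normal_half_moment p * normal_half_moment q)"
proof -
  let ?g = "\<lambda>n x. exp (- x\<^sup>2) / sqrt pi * x ^ n :: real"
  have int: "integrable lborel (?g n)" and val: "integral\<^sup>L lborel (?g n) = normal_half_moment n" for n
    using has_bochner_integral_normal_half_moment[of n] by (auto simp: has_bochner_integral_iff)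
  have "integrable (lborel \<Otimes>\<^sub>M lborel) (\<lambda>(x, y). ?g p x * ?g q y)"
    using int integrable_norm[OF int]
    by (intro lborel_pair.Fubini_integrable) (simp_all add: abs_mult del: times_divide_eq_left)
  moreover from this have "integral\<^sup>L (lborel \<Otimes>\<^sub>M lborel) (\<lambda>(x, y). ?g p x * ?g q y)
      = normal_half_moment p * normal_half_moment q"
    using lborel_pair.integral_fst[of "\<lambda>x y. ?g p x * ?g q y"] by (simp add: val del: times_divide_eq_left)
  ultimately have "has_bochner_integral (lborel \<Otimes>\<^sub>M lborel) (\<lambda>(x, y). ?g p x * ?g q y)
      (normal_half_moment p * normal_half_moment q)"
    by (simp add: has_bochner_integral_iff)
  also have "(\<lambda>(x, y). ?g p x * ?g q y) = (\<lambda>w. (\<lambda>z. (exp (- (cmod z)\<^sup>2) / pi) *\<^sub>R (Re z ^ p * Im z ^ q))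
       ((\<lambda>(x, y). Complex x y) w))"
    by (auto simp: fun_eq_iff cmod_power2 exp_add[symmetric] algebra_simps exp_diff exp_minus field_simps)
  finally have "has_bochner_integral (distr (lborel \<Otimes>\<^sub>M lborel) borel (\<lambda>(x, y). Complex x y))
      (\<lambda>z. (exp (- (cmod z)\<^sup>2) / pi) *\<^sub>R (Re z ^ p * Im z ^ q))
      (normal_half_moment p * normal_half_moment q)"
    by (intro has_bochner_integral_distr) (auto simp: Complex_eq)
  then show ?thesis
    unfolding cgauss_def lborel_complex[symmetric]
    by (intro has_bochner_integral_density) auto
qed

lemma prob_space_cgauss: "prob_space cgauss"
proof (rule prob_spaceI)
  have *: "has_bochner_integral cgauss (\<lambda>z. 1 :: real) 1"
    using has_bochner_integral_cgauss_Re_Im[of 0 0] by (simp add: normal_half_moment_def)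
  then have "emeasure cgauss (space cgauss) = ennreal (integral\<^sup>L cgauss (\<lambda>_. 1))"
    using nn_integral_eq_integral[of cgauss "\<lambda>_. 1::real"]
    by (auto simp: has_bochner_integral_iff)
  then show "emeasure cgauss (space cgauss) = 1"
    using has_bochner_integral_integral_eq[OF *] by simp
qed

text \<open>The substitution z -> sqrt(1+t) z absorbs the extra damping into the Gaussian weight.
  Since the plane has real dimension 2, the Jacobian is 1+t.\<close>

lemma has_bochner_integral_cgauss_scale:
  fixes g :: "complex \<Rightarrow> complex"
  assumes g: "has_bochner_integral cgauss g x" and t: "t > -1"
  shows "has_bochner_integral cgauss
      (\<lambda>z. complex_of_real (exp (- t * (cmod z)\<^sup>2)) * g (complex_of_real (sqrt (1 + t)) * z)) (x / (1 + t))"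
proof -
  define s where "s = sqrt (1 + t)"
  have s: "s > 0" "s\<^sup>2 = 1 + t" using t by (auto simp: s_def)
  have [measurable]: "g \<in> borel_measurable borel"
    using g by (auto simp: has_bochner_integral_iff cgauss_def dest: borel_measurable_integrable)
  let ?h = "\<lambda>z. (exp (- (cmod z)\<^sup>2) / pi) *\<^sub>R g z"
  have "has_bochner_integral lborel ?h x"
    using g by (simp add: cgauss_def has_bochner_integral_iff integrable_density integral_density)
  also have "(lborel :: complex measure) = density (distr lborel borel (\<lambda>z. 0 + s *\<^sub>R z)) (\<lambda>_. s\<^sup>2)"
    using lborel_affine[of s "0 :: complex"] s by simp
  finally have "has_bochner_integral lborel (\<lambda>z. s\<^sup>2 *\<^sub>R ?h (s *\<^sub>R z)) x"
    by (simp add: has_bochner_integral_iff integrable_density integral_density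
        integrable_distr_eq integral_distr)
  then have "has_bochner_integral lborel (\<lambda>z. inverse (s\<^sup>2) *\<^sub>R (s\<^sup>2 *\<^sub>R ?h (s *\<^sub>R z))) (inverse (s\<^sup>2) *\<^sub>R x)"
    by (rule has_bochner_integral_scaleR_right)
  moreover have "inverse (s\<^sup>2) *\<^sub>R (s\<^sup>2 *\<^sub>R y) = y" for y :: complex
    using \<open>s > 0\<close> by simp
  moreover have "inverse (s\<^sup>2) *\<^sub>R x = x / (1 + t)"
    by (simp add: s scaleR_conv_of_real divide_inverse mult.commute)
  ultimately have "has_bochner_integral lborel (\<lambda>z. ?h (s *\<^sub>R z)) (x / (1 + t))"
    by (simp only:)
  also have "(\<lambda>z. ?h (s *\<^sub>R z)) = (\<lambda>z. (exp (- (cmod z)\<^sup>2) / pi) *\<^sub>R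
       (complex_of_real (exp (- t * (cmod z)\<^sup>2)) * g (complex_of_real s * z)))"
  proof
    fix z :: complex
    have "exp (- (cmod (s *\<^sub>R z))\<^sup>2) = exp (- (cmod z)\<^sup>2) * exp (- t * (cmod z)\<^sup>2)"
      by (simp add: power_mult_distrib s exp_add[symmetric] algebra_simps)
    then show "?h (s *\<^sub>R z) = (exp (- (cmod z)\<^sup>2) / pi) *\<^sub>R
       (complex_of_real (exp (- t * (cmod z)\<^sup>2)) * g (complex_of_real s * z))"
      by (simp add: scaleR_conv_of_real)
  qed
  finally show ?thesis
    unfolding cgauss_def s_def[symmetric] by (intro has_bochner_integral_density) auto
qed

definition cgauss_mixed_moment :: "nat \<Rightarrow> nat \<Rightarrow> nat \<Rightarrow> nat \<Rightarrow> complex" where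
  "cgauss_mixed_moment a b p q =
     (\<integral>z. z ^ a * cnj z ^ b * complex_of_real (Re z ^ p * Im z ^ q) \<partial>cgauss)"

text \<open>Expanding one factor as Re z + i Im z, or its conjugate, trades complex powers for real
  ones. Integrability and the recursion for the moments both rest on this.\<close>

lemma cgauss_mixed_split:
  fixes z :: complex
  shows "z ^ Suc a * cnj z ^ b * complex_of_real (Re z ^ p * Im z ^ q) =
      z ^ a * cnj z ^ b * complex_of_real (Re z ^ Suc p * Im z ^ q)
      + \<i> * (z ^ a * cnj z ^ b * complex_of_real (Re z ^ p * Im z ^ Suc q))" (is ?A)
    and "z ^ a * cnj z ^ Suc b * complex_of_real (Re z ^ p * Im z ^ q) =
      z ^ a * cnj z ^ b * complex_of_real (Re z ^ Suc p * Im z ^ q)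
      - \<i> * (z ^ a * cnj z ^ b * complex_of_real (Re z ^ p * Im z ^ Suc q))" (is ?B)
proof -
  have 1: "z ^ Suc a * w = z ^ a * w * complex_of_real (Re z) + \<i> * (z ^ a * w * complex_of_real (Im z))" for w
  proof -
    have "z ^ Suc a * w = z ^ a * w * (complex_of_real (Re z) + \<i> * complex_of_real (Im z))"
      by (simp flip: complex_eq)
    then show ?thesis by (simp only: algebra_simps)
  qed
  have 2: "cnj z ^ Suc b * w = cnj z ^ b * w * complex_of_real (Re z) - \<i> * (cnj z ^ b * w * complex_of_real (Im z))" for w
  proof -
    have "cnj z = complex_of_real (Re z) - \<i> * complex_of_real (Im z)"
      by (simp add: complex_eq_iff)
    then have "cnj z ^ Suc b * w = cnj z ^ b * w * (complex_of_real (Re z) - \<i> * complex_of_real (Im z))"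
      by simp
    then show ?thesis by (simp only: algebra_simps)
  qed
  show ?A
    using 1[of "cnj z ^ b * complex_of_real (Re z ^ p * Im z ^ q)"] by (simp add: algebra_simps)
  show ?B
    using 2[of "z ^ a * complex_of_real (Re z ^ p * Im z ^ q)"] by (simp add: algebra_simps)
qed

lemma integrable_cgauss_mixed:
  "integrable cgauss (\<lambda>z. z ^ a * cnj z ^ b * complex_of_real (Re z ^ p * Im z ^ q))"
proof (induction a arbitrary: p q)
  case 0
  show ?case
  proof (induction b arbitrary: p q)
    case 0
    have "integrable cgauss (\<lambda>z. Re z ^ p * Im z ^ q)"
      using has_bochner_integral_cgauss_Re_Im by (simp add: has_bochner_integral_iff)
    then show ?case by (simp only: power_0 mult_1 integrable_of_real)
  next
    case (Suc b)
    then show ?case unfolding cgauss_mixed_split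
      by (intro Bochner_Integration.integrable_diff integrable_mult_right)
  qed
next
  case (Suc a)
  then show ?case unfolding cgauss_mixed_split
    by (intro Bochner_Integration.integrable_add integrable_mult_right)
qed

lemma cgauss_mixed_moment_Suc:
  "cgauss_mixed_moment (Suc a) b p q = cgauss_mixed_moment a b (Suc p) q + \<i> * cgauss_mixed_moment a b p (Suc q)"
  "cgauss_mixed_moment a (Suc b) p q = cgauss_mixed_moment a b (Suc p) q - \<i> * cgauss_mixed_moment a b p (Suc q)"
  unfolding cgauss_mixed_moment_def cgauss_mixed_split
  by (subst Bochner_Integration.integral_add Bochner_Integration.integral_diff,
      (intro integrable_cgauss_mixed integrable_mult_right)+, simp)+

lemma cgauss_mixed_moment_0:
  "cgauss_mixed_moment 0 0 p q = complex_of_real (normal_half_moment p * normal_half_moment q)"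
  unfolding cgauss_mixed_moment_def
  using has_bochner_integral_integral_eq[OF has_bochner_integral_cgauss_Re_Im[of p q]]
  by (simp only: power_0 mult_1 integral_complex_of_real)

text \<open>Gaussian integration by parts, \<open>E[z F] = E[\<partial>F/\<partial>(cnj z)]\<close>. The factors \<open>Re z ^ p * Im z ^ q\<close>
  only serve to make the induction go through.\<close>
lemma cgauss_mixed_moment_by_parts:
  "cgauss_mixed_moment (Suc a) b p q = of_nat b * cgauss_mixed_moment a (b - 1) p q
     + of_nat p / 2 * cgauss_mixed_moment a b (p - 1) q
     + \<i> * of_nat q / 2 * cgauss_mixed_moment a b p (q - 1)"
proof (induction a arbitrary: b p q)
  case 0
  show ?case
  proof (induction b arbitrary: p q)
    case 0
    have *: "normal_half_moment (Suc n) = real n / 2 * normal_half_moment (n - 1)" for n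
      by (cases n) (simp_all add: normal_half_moment_Suc_Suc)
    show ?case
      by (simp add: cgauss_mixed_moment_Suc cgauss_mixed_moment_0 * algebra_simps)
  next
    case (Suc b)
    show ?case
      unfolding cgauss_mixed_moment_Suc(2)[of "Suc 0"] Suc.IH[of "Suc p" q] Suc.IH[of p "Suc q"]
      by (cases b; cases p; cases q)
        (simp_all add: cgauss_mixed_moment_Suc(2)[of 0] algebra_simps add_divide_distrib)
  qed
next
  case (Suc a)
  show ?case
    unfolding cgauss_mixed_moment_Suc(1)[of "Suc a"] Suc.IH[of b "Suc p" q] Suc.IH[of b p "Suc q"]
    by (cases p; cases q)
      (simp_all add: cgauss_mixed_moment_Suc(1)[of a] algebra_simps add_divide_distrib)
qed

text \<open>At p = q = 0 integration by parts lowers both exponents by one with factor b, which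
  produces the factorial on the diagonal. Once z is used up, a pure power of \<open>cnj z\<close> is
  the conjugate of a pure power of z, and that has mean 0.\<close>

lemma has_bochner_integral_cgauss_moment:
  "has_bochner_integral cgauss (\<lambda>z. z ^ a * cnj z ^ b) (if a = b then fact a else 0)"
proof -
  have 1: "cgauss_mixed_moment a b 0 0 = (if a = b then fact a else 0)" for a b
  proof (induction a arbitrary: b)
    case 0
    have "cgauss_mixed_moment 0 (Suc b) 0 0 = cnj (cgauss_mixed_moment (Suc b) 0 0 0)" for b
      unfolding cgauss_mixed_moment_def using Bochner_Integration.integral_cnj[where M = cgauss and f = "\<lambda>z. z ^ Suc b"] by simp
    then show ?case
      by (cases b) (simp_all add: cgauss_mixed_moment_by_parts cgauss_mixed_moment_0 normal_half_moment_def)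
  next
    case (Suc a)
    then show ?case
      by (cases b) (simp_all add: cgauss_mixed_moment_by_parts)
  qed
  show ?thesis
    using integrable_cgauss_mixed[of a b 0 0] 1[of a b]
    by (simp add: has_bochner_integral_iff cgauss_mixed_moment_def)
qed

text \<open>The Jacobian gives one factor 1/(1+t), and undoing the rescaling in the monomial gives
  (1+t)^(-(a+b)/2). For a = b these combine to exponent a+1; otherwise the moment is 0, so writing
  the exponent in terms of a alone is harmless.\<close>

lemma has_bochner_integral_cgauss_moment_exp:
  assumes "t \<ge> 0"
  shows "has_bochner_integral cgauss (\<lambda>z. complex_of_real (exp (- t * (cmod z)\<^sup>2)) * (z ^ a * cnj z ^ b))
     (complex_of_real ((if a = b then fact a else 0) / (1 + t) ^ Suc a))"
proof -
  define s where "s = sqrt (1 + t)"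
  have s: "s > 0" "s\<^sup>2 = 1 + t" using assms by (auto simp: s_def)
  have "has_bochner_integral cgauss
      (\<lambda>z. complex_of_real (exp (- t * (cmod z)\<^sup>2)) *
           ((complex_of_real s * z) ^ a * cnj (complex_of_real s * z) ^ b) * inverse (complex_of_real s ^ (a + b)))
      ((if a = b then fact a else 0) / (1 + t) * inverse (complex_of_real s ^ (a + b)))"
    using has_bochner_integral_cgauss_scale[OF has_bochner_integral_cgauss_moment[of a b], of t] assms
    unfolding s_def[symmetric] by (intro has_bochner_integral_mult_left) auto
  also have "(\<lambda>z. complex_of_real (exp (- t * (cmod z)\<^sup>2)) *
           ((complex_of_real s * z) ^ a * cnj (complex_of_real s * z) ^ b) * inverse (complex_of_real s ^ (a + b)))
      = (\<lambda>z. complex_of_real (exp (- t * (cmod z)\<^sup>2)) * (z ^ a * cnj z ^ b))"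
    using s by (simp add: fun_eq_iff power_mult_distrib power_add field_simps)
  also have "(if a = b then fact a else 0) / (1 + t) * inverse (complex_of_real s ^ (a + b))
      = complex_of_real ((if a = b then fact a else 0) / (1 + t) ^ Suc a)"
  proof -
    have "s ^ (a + a) = (1 + t) ^ a"
      by (simp add: s(2)[symmetric] power_mult[symmetric] mult_2)
    then have "complex_of_real s ^ (a + a) = (1 + complex_of_real t) ^ a"
      by (metis of_real_1 of_real_add of_real_power)
    moreover have "1 + complex_of_real t \<noteq> 0"
      using assms by (metis add_nonneg_eq_0_iff of_real_1 of_real_add of_real_eq_0_iff zero_le_one zero_neq_one)
    ultimately show ?thesis using s by (auto simp: divide_simps)
  qed
  finally show ?thesis .
qed

section \<open>Gaussian vectors and their normalisation to the unit sphere\<close>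

interpretation cgauss: prob_space cgauss
  by (rule prob_space_cgauss)

interpretation cgauss_product: product_prob_space "\<lambda>_. cgauss" I for I
  by standard

abbreviation sqnorm_on :: "'i set \<Rightarrow> ('i \<Rightarrow> complex) \<Rightarrow> real" where
  "sqnorm_on I z \<equiv> (\<Sum>i\<in>I. (cmod (z i))\<^sup>2)"

abbreviation mixed_monomial :: "'i set \<Rightarrow> ('i \<Rightarrow> nat) \<Rightarrow> ('i \<Rightarrow> nat) \<Rightarrow> ('i \<Rightarrow> complex) \<Rightarrow> complex" where
  "mixed_monomial I \<alpha> \<beta> z \<equiv> (\<Prod>i\<in>I. z i ^ \<alpha> i * cnj (z i) ^ \<beta> i)"

abbreviation gauss_moment :: "'i set \<Rightarrow> ('i \<Rightarrow> nat) \<Rightarrow> ('i \<Rightarrow> nat) \<Rightarrow> nat" where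
  "gauss_moment I \<alpha> \<beta> \<equiv> (\<Prod>i\<in>I. if \<alpha> i = \<beta> i then fact (\<alpha> i) else 0)"

text \<open>The coordinates are independent, so the exponents of 1+t add up. The t-dependence sees
  \<open>\<alpha>\<close> only through its total degree, which is why one constant will serve all
  Haar moments of that degree.\<close>

lemma has_bochner_integral_gauss_vector_exp:
  assumes "finite I" "t \<ge> 0"
  shows "has_bochner_integral (PiM I (\<lambda>_. cgauss))
     (\<lambda>z. complex_of_real (exp (- t * sqnorm_on I z)) * mixed_monomial I \<alpha> \<beta> z)
     (complex_of_real (gauss_moment I \<alpha> \<beta> / (1 + t) ^ (card I + sum \<alpha> I)))"
proof -
  let ?f = "\<lambda>i z. complex_of_real (exp (- t * (cmod z)\<^sup>2)) * (z ^ \<alpha> i * cnj z ^ \<beta> i)"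
  have f: "integrable cgauss (?f i)"
    "integral\<^sup>L cgauss (?f i) = complex_of_real ((if \<alpha> i = \<beta> i then fact (\<alpha> i) else 0) / (1 + t) ^ Suc (\<alpha> i))" for i
    using has_bochner_integral_cgauss_moment_exp[OF \<open>t \<ge> 0\<close>, of "\<alpha> i" "\<beta> i"]
    unfolding has_bochner_integral_iff by blast+
  have "has_bochner_integral (PiM I (\<lambda>_. cgauss)) (\<lambda>z. \<Prod>i\<in>I. ?f i (z i))
     (\<Prod>i\<in>I. complex_of_real ((if \<alpha> i = \<beta> i then fact (\<alpha> i) else 0) / (1 + t) ^ Suc (\<alpha> i)))"
    unfolding has_bochner_integral_iff f(2)[symmetric]
    by (intro conjI cgauss_product.product_integrable_prod cgauss_product.product_integral_prod assms f(1))
  also have "(\<lambda>z. \<Prod>i\<in>I. ?f i (z i)) =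
      (\<lambda>z. complex_of_real (exp (- t * sqnorm_on I z)) * mixed_monomial I \<alpha> \<beta> z)"
    by (simp add: fun_eq_iff prod.distrib sum_distrib_left exp_sum[OF assms(1)] sum_negf[symmetric] del: sum_negf)
  also have "(\<Prod>i\<in>I. complex_of_real ((if \<alpha> i = \<beta> i then fact (\<alpha> i) else 0) / (1 + t) ^ Suc (\<alpha> i)))
      = complex_of_real (gauss_moment I \<alpha> \<beta> / (1 + t) ^ (card I + sum \<alpha> I))"
  proof -
    have "(\<Prod>i\<in>I. (1 + t) ^ Suc (\<alpha> i)) = (1 + t) ^ (\<Sum>i\<in>I. Suc (\<alpha> i))"
      by (rule power_sum[symmetric])
    also have "(\<Sum>i\<in>I. Suc (\<alpha> i)) = card I + sum \<alpha> I"
      by (simp add: sum_Suc)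
    finally show ?thesis
      unfolding of_real_prod[symmetric] prod_dividef by (simp add: if_distrib cong: if_cong)
  qed
  finally show ?thesis .
qed

text \<open>This is the total mass of the Erlang density with rate l. It serves to replace an
  inverse power of the squared norm by exponentials, which factor over coordinates.\<close>

lemma has_bochner_integral_erlang:
  fixes l :: real
  assumes "l > 0"
  shows "has_bochner_integral lborel (\<lambda>t. indicator {0..} t * t ^ k / fact k * exp (- t * l)) (1 / l ^ Suc k)"
proof -
  have "emeasure (density lborel (erlang_density k l)) UNIV = 1"
    using prob_space.emeasure_space_1[OF prob_space_erlang_density[OF assms]] by simp
  then have "has_bochner_integral lborel (erlang_density k l) 1"
    using assms by (intro has_bochner_integral_nn_integral) (auto simp: emeasure_density)
  then have "has_bochner_integral lborel (\<lambda>t. erlang_density k l t / l ^ Suc k) (1 / l ^ Suc k)"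
    by (rule has_bochner_integral_divide_zero)
  also have "(\<lambda>t. erlang_density k l t / l ^ Suc k) = (\<lambda>t. indicator {0..} t * t ^ k / fact k * exp (- t * l))"
    using assms by (auto simp: fun_eq_iff erlang_density_def indicator_def mult.commute)
  finally show ?thesis .
qed

lemma borel_measurable_cnj [measurable (raw)]:
  "f \<in> borel_measurable M \<Longrightarrow> (\<lambda>x. cnj (f x)) \<in> borel_measurable M"
  by (rule borel_measurable_continuous_on[where f = cnj]) (intro continuous_intros)

lemma sets_PiM_cgauss [measurable_cong]: "sets (PiM I (\<lambda>_. cgauss)) = sets (PiM I (\<lambda>_. borel))"
  by (intro sets_PiM_cong) (auto simp: sets_cgauss)

lemma measurable_normalize [measurable]:
  "(\<lambda>z. restrict (\<lambda>i. z i / complex_of_real (sqrt (sqnorm_on I z))) I)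
     \<in> measurable (PiM I (\<lambda>_. borel)) (PiM I (\<lambda>_. borel))"
  by (intro measurable_restrict borel_measurable_divide) measurable

lemma norm_mixed_monomial_le:
  assumes "\<And>i. i \<in> I \<Longrightarrow> cmod (z i) \<le> r"
  shows "cmod (mixed_monomial I \<alpha> \<beta> z) \<le> r ^ (sum \<alpha> I + sum \<beta> I)"
proof -
  have "cmod (mixed_monomial I \<alpha> \<beta> z) = (\<Prod>i\<in>I. cmod (z i) ^ (\<alpha> i + \<beta> i))"
    by (simp add: prod_norm[symmetric] norm_mult norm_power power_add)
  also have "\<dots> \<le> (\<Prod>i\<in>I. r ^ (\<alpha> i + \<beta> i))"
    by (intro prod_mono conjI power_mono assms) auto
  finally show ?thesis by (simp add: power_sum[symmetric] sum.distrib)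
qed

text \<open>The bound includes the zero vector, where division by zero returns 0.\<close>

lemma norm_normalize_le:
  assumes "finite I" "i \<in> I"
  shows "cmod (z i / complex_of_real (sqrt (sqnorm_on I z))) \<le> 1"
proof -
  have "(cmod (z i))\<^sup>2 \<le> sqnorm_on I z"
    using assms by (intro member_le_sum) auto
  then have "cmod (z i) \<le> sqrt (sqnorm_on I z)"
    by (simp add: real_le_rsqrt)
  moreover have "sqnorm_on I z \<ge> 0"
    by (simp add: sum_nonneg)
  ultimately show ?thesis
    by (auto simp: norm_divide divide_le_eq_1)
qed

lemma prob_space_haar_sphere: "prob_space (haar_sphere I)"
  unfolding haar_sphere_def
  by (intro prob_space.prob_space_distr cgauss_product.P.prob_space_axioms) measurable

lemma sets_haar_sphere [measurable_cong]: "sets (haar_sphere I) = sets (PiM I (\<lambda>_. borel))"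
  by (simp add: haar_sphere_def)

lemma AE_haar_sphere_norm_le:
  assumes "finite I"
  shows "AE \<psi> in haar_sphere I. \<forall>i\<in>I. cmod (\<psi> i) \<le> 1"
  unfolding haar_sphere_def
  using norm_normalize_le[OF assms] assms by (subst AE_distr_iff) (auto; measurable)+

lemma integrable_haar_sphere_monomial:
  assumes "finite I"
  shows "integrable (haar_sphere I) (mixed_monomial I \<alpha> \<beta>)"
proof -
  interpret prob_space "haar_sphere I" by (rule prob_space_haar_sphere)
  show ?thesis
    using AE_haar_sphere_norm_le[OF assms] norm_mixed_monomial_le[of I _ 1 \<alpha> \<beta>]
    by (intro integrable_const_bound[of _ 1]) (auto elim!: eventually_mono)
qed

text \<open>Write \<open>1 / |z|^(2n)\<close> as an integral of \<open>t^(n-1) * exp (- t * |z|^2)\<close>; rescaling the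
  Gaussian then turns the inner expectation into the Gaussian moment times a function of \<open>t\<close> alone.\<close>
lemma haar_sphere_moments:
  assumes "finite I"
  shows "\<exists>\<kappa>::real. \<forall>\<alpha> \<beta>. sum \<alpha> I = Suc k \<longrightarrow> sum \<beta> I = Suc k \<longrightarrow>
     integral\<^sup>L (haar_sphere I) (mixed_monomial I \<alpha> \<beta>) = complex_of_real (\<kappa> * gauss_moment I \<alpha> \<beta>)"
proof (intro exI allI impI)
  fix \<alpha> \<beta> :: "'a \<Rightarrow> nat"
  assume deg: "sum \<alpha> I = Suc k" "sum \<beta> I = Suc k"
  let ?G = "PiM I (\<lambda>_. cgauss)"
  let ?P = "mixed_monomial I \<alpha> \<beta>"
  let ?S = "sqnorm_on I"
  define h :: "real \<Rightarrow> real" where "h t = indicator {0..} t * t ^ k / fact k" for t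
  have h_nonneg: "h t \<ge> 0" for t by (simp add: h_def indicator_def)
  have [measurable]: "h \<in> borel_measurable borel" unfolding h_def by measurable
  have S_nonneg: "?S z \<ge> 0" for z by (simp add: sum_nonneg)
  \<comment> \<open>At the origin the exponential no longer damps the t-integral. The positive
    degree makes the monomial vanish there, and the quotient is 0 by the convention for division by
    zero.\<close>
  have P0: "?P z = 0" if "?S z = 0" for z
  proof -
    have "\<forall>i\<in>I. z i = 0" using that assms by (subst (asm) sum_nonneg_eq_0_iff) auto
    moreover obtain i where "i \<in> I" "\<alpha> i \<noteq> 0"
      using deg by (metis nat.distinct(1) sum.neutral)
    ultimately show ?thesis using assms by (intro prod_zero) auto
  qed
  have int_h: "has_bochner_integral lborel (\<lambda>t. complex_of_real (h t * exp (- t * ?S z)) * ?P z)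
      (?P z / complex_of_real (?S z ^ Suc k))" for z
  proof (cases "?S z = 0")
    case False
    then have "?S z > 0" using S_nonneg[of z] by linarith
    from has_bochner_integral_of_real[OF has_bochner_integral_erlang[OF this, of k], where 'a = complex]
    have "has_bochner_integral lborel (\<lambda>t. complex_of_real (h t * exp (- t * ?S z)) * ?P z)
      (complex_of_real (1 / ?S z ^ Suc k) * ?P z)"
      unfolding h_def by (rule has_bochner_integral_mult_left)
    then show ?thesis by simp
  qed (simp add: P0 has_bochner_integral_zero)
  have int_norm: "(\<integral>t. cmod (complex_of_real (h t * exp (- t * ?S z)) * ?P z) \<partial>lborel)
      = cmod (?P z) / ?S z ^ Suc k" for z
  proof (cases "?S z = 0")
    case False
    then have "?S z > 0" using S_nonneg[of z] by linarith
    from has_bochner_integral_mult_left[OF has_bochner_integral_erlang[OF this, of k], of "cmod (?P z)"]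
    have "has_bochner_integral lborel (\<lambda>t. h t * exp (- t * ?S z) * cmod (?P z))
        (1 / ?S z ^ Suc k * cmod (?P z))"
      unfolding h_def .
    moreover have "cmod (complex_of_real (h t * exp (- t * ?S z)) * ?P z) = h t * exp (- t * ?S z) * cmod (?P z)" for t
      using h_nonneg[of t] by (simp add: norm_mult del: of_real_mult)
    ultimately show ?thesis
      by (simp add: has_bochner_integral_iff)
  qed (simp add: P0)
  \<comment> \<open>The total degree is even, so the square roots combine to an integer power of the
    squared norm.\<close>
  have normalized: "?P (restrict (\<lambda>i. z i / complex_of_real (sqrt (?S z))) I)
      = ?P z / complex_of_real (?S z ^ Suc k)" for z
  proof -
    have "?P (restrict (\<lambda>i. z i / complex_of_real (sqrt (?S z))) I)
        = (\<Prod>i\<in>I. z i ^ \<alpha> i * cnj (z i) ^ \<beta> i / complex_of_real (sqrt (?S z)) ^ (\<alpha> i + \<beta> i))"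
      by (intro prod.cong) (auto simp: power_divide power_add)
    also have "\<dots> = ?P z / complex_of_real (sqrt (?S z)) ^ (\<Sum>i\<in>I. \<alpha> i + \<beta> i)"
      by (simp only: prod_dividef power_sum)
    also have "(\<Sum>i\<in>I. \<alpha> i + \<beta> i) = 2 * Suc k"
      using deg by (simp add: sum.distrib)
    also have "complex_of_real (sqrt (?S z)) ^ (2 * Suc k) = complex_of_real (?S z ^ Suc k)"
      by (simp only: power_mult of_real_power[symmetric] real_sqrt_pow2[OF S_nonneg])
    finally show ?thesis .
  qed
  interpret pair_sigma_finite ?G lborel
    by (intro pair_sigma_finite.intro cgauss_product.P.sigma_finite_measure_axioms lborel.sigma_finite_measure_axioms)
  have int_pair: "integrable (?G \<Otimes>\<^sub>M lborel) (\<lambda>(z, t). complex_of_real (h t * exp (- t * ?S z)) * ?P z)"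
  proof (rule Fubini_integrable)
    show "(\<lambda>(z, t). complex_of_real (h t * exp (- t * ?S z)) * ?P z) \<in> borel_measurable (?G \<Otimes>\<^sub>M lborel)"
      by measurable
    \<comment> \<open>The inner integral of the norm equals the modulus of the monomial at the
      normalised vector, hence is at most 1 and integrable over a probability space.\<close>
    have "cmod (?P z / complex_of_real (?S z ^ Suc k)) \<le> 1" for z
      using norm_mixed_monomial_le[of I "restrict (\<lambda>i. z i / complex_of_real (sqrt (?S z))) I" 1 \<alpha> \<beta>]
        norm_normalize_le[OF assms] unfolding normalized by simp
    then have "cmod (?P z) / ?S z ^ Suc k \<le> 1" for z
      by (simp only: norm_divide norm_of_real abs_of_nonneg[OF zero_le_power[OF S_nonneg]])
    then show "integrable ?G (\<lambda>z. \<integral>t. norm (case (z, t) of (z, t) \<Rightarrow> complex_of_real (h t * exp (- t * ?S z)) * ?P z) \<partial>lborel)"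
      unfolding split int_norm
      using S_nonneg by (intro cgauss_product.P.integrable_const_bound[of _ 1]) (auto simp del: power_Suc)
    show "AE z in ?G. integrable lborel (\<lambda>t. case (z, t) of (z, t) \<Rightarrow> complex_of_real (h t * exp (- t * ?S z)) * ?P z)"
      using int_h by (auto simp: has_bochner_integral_iff)
  qed
  have "integral\<^sup>L (haar_sphere I) ?P = (\<integral>z. ?P z / complex_of_real (?S z ^ Suc k) \<partial>?G)"
    unfolding haar_sphere_def normalized[symmetric] by (rule integral_distr) measurable
  also have "\<dots> = (\<integral>z. (\<integral>t. complex_of_real (h t * exp (- t * ?S z)) * ?P z \<partial>lborel) \<partial>?G)"
    using int_h by (simp add: has_bochner_integral_iff)
  also have "\<dots> = (\<integral>t. (\<integral>z. complex_of_real (h t * exp (- t * ?S z)) * ?P z \<partial>?G) \<partial>lborel)"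
    by (rule Fubini_integral[OF int_pair, symmetric])
  \<comment> \<open>Degree \<open>Suc k\<close> fixes the power of 1+t, so what remains of the
    t-integral is the same for all \<open>\<alpha>\<close>, \<open>\<beta>\<close>; this is the
    witness for the constant.\<close>
  also have "\<dots> = (\<integral>t. complex_of_real (h t / (1 + t) ^ (card I + Suc k)) * complex_of_real (gauss_moment I \<alpha> \<beta>) \<partial>lborel)"
  proof (intro Bochner_Integration.integral_cong refl)
    fix t :: real
    show "(\<integral>z. complex_of_real (h t * exp (- t * ?S z)) * ?P z \<partial>?G)
      = complex_of_real (h t / (1 + t) ^ (card I + Suc k)) * complex_of_real (gauss_moment I \<alpha> \<beta>)"
    proof (cases "t \<ge> 0")
      case True
      from has_bochner_integral_mult_right[OF has_bochner_integral_gauss_vector_exp[OF assms this, of \<alpha> \<beta>],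
          THEN has_bochner_integral_integral_eq, of "complex_of_real (h t)"]
      show ?thesis by (simp add: deg mult.assoc del: power_Suc)
    qed (simp add: h_def)
  qed
  also have "\<dots> = complex_of_real ((\<integral>t. h t / (1 + t) ^ (card I + Suc k) \<partial>lborel) * gauss_moment I \<alpha> \<beta>)"
    unfolding of_real_mult integral_complex_of_real[symmetric] by (rule integral_mult_left_zero)
  finally show "integral\<^sup>L (haar_sphere I) ?P =
    complex_of_real ((\<integral>t. (indicator {0..} t * t ^ k / fact k) / (1 + t) ^ (card I + Suc k) \<partial>lborel) * gauss_moment I \<alpha> \<beta>)"
    unfolding h_def .
qed

subsection \<open>Permutations of four replicas\<close>

text \<open>One-line notation: \<open>p ! k\<close> is the image of k. Lists keep the finite checks
  over the group executable.\<close>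

definition perms4 :: "nat list set" where
  "perms4 = set (filter distinct (List.n_lists 4 [0,1,2,3]))"

lemma perms4_eq: "perms4 = {[0,1,2,3],[0,1,3,2],[0,2,1,3],[0,2,3,1],[0,3,1,2],[0,3,2,1],
  [1,0,2,3],[1,0,3,2],[1,2,0,3],[1,2,3,0],[1,3,0,2],[1,3,2,0],
  [2,0,1,3],[2,0,3,1],[2,1,0,3],[2,1,3,0],[2,3,0,1],[2,3,1,0],
  [3,0,1,2],[3,0,2,1],[3,1,0,2],[3,1,2,0],[3,2,0,1],[3,2,1,0]}"
  unfolding perms4_def by code_simp

text \<open>For permutations these are the functions constant on the cycles of q composed with the
  inverse of p. Their number is \<open>card X\<close> to the number of cycles, that is, to 4 minus
  the Cayley distance.\<close>

definition agreeing :: "'a set \<Rightarrow> nat list \<Rightarrow> nat list \<Rightarrow> (nat \<Rightarrow> 'a) set" where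
  "agreeing X p q = {l \<in> {..<4} \<rightarrow>\<^sub>E X. \<forall>k<4. l (p ! k) = l (q ! k)}"

text \<open>The values on \<open>[1,0,3,2]\<close>, \<open>[2,3,0,1]\<close>, \<open>[3,2,1,0]\<close> are forced by the boundary; the others are
  chosen so that permutations differing by a transposition are separated by at most one colouring.\<close>
definition colour0 :: "nat list \<Rightarrow> nat" where
  "colour0 p = (if p = [3,2,1,0] then 3
     else if p \<in> {[2,3,0,1], [2,3,1,0], [3,2,0,1]} then 2 else 1)"

definition colour1 :: "nat list \<Rightarrow> nat" where
  "colour1 p = (if p = [1,0,3,2] then 1
     else if p \<in> {[2,3,0,1], [2,1,0,3], [0,3,2,1], [1,3,0,2], [2,0,3,1]} then 2 else 3)"

text \<open>Distinct permutations differ at exactly two positions when they are a transposition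
  apart and at three or more otherwise. So the condition says that spins separated by both
  colourings have Cayley distance at least 2, in a form that evaluates directly.\<close>

lemma colour_check:
  "\<forall>p\<in>perms4. \<forall>q\<in>perms4. colour0 p \<noteq> colour0 q \<longrightarrow> colour1 p \<noteq> colour1 q \<longrightarrow>
     length (filter (\<lambda>k. p ! k \<noteq> q ! k) [0,1,2,3]) \<ge> 3"
  unfolding perms4_eq by code_simp

text \<open>This yields uniqueness of the dominant configuration: where both colourings induce the
  same part, the spin must be one of the boundary ones.\<close>

lemma colour_eq:
  "\<forall>p\<in>perms4. colour0 p = colour1 p \<longrightarrow> p = [1,0,3,2] \<or> p = [2,3,0,1] \<or> p = [3,2,1,0]"
  unfolding perms4_eq by code_simp

lemma less_4_iff: "k < (4::nat) \<longleftrightarrow> k = 0 \<or> k = 1 \<or> k = 2 \<or> k = 3"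
  by presburger

lemma perms4_D:
  assumes "p \<in> perms4"
  shows "length p = 4" "distinct p" "k < 4 \<Longrightarrow> p ! k < 4"
proof -
  have "length p = 4 \<and> distinct p \<and> set p \<subseteq> {0,1,2,3}"
    using assms by (auto simp: perms4_def set_n_lists)
  moreover from this have "p ! k \<in> set p" if "k < 4" using that by simp
  ultimately show "length p = 4" "distinct p" "k < 4 \<Longrightarrow> p ! k < 4" by fastforce+
qed

lemma finite_agreeing [simp]: "finite X \<Longrightarrow> finite (agreeing X p q)"
  by (rule finite_subset[OF _ finite_PiE[of "{..<4}" "\<lambda>_. X"]]) (auto simp: agreeing_def)

lemma card_agreeing_self: "card (agreeing X p p) = card X ^ 4"
  by (simp add: agreeing_def card_PiE)

text \<open>Restriction to T is injective on S. In the applications T omits the positions whose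
  values are forced by the others.\<close>

lemma card_le_if_determined_on:
  assumes "finite X" "S \<subseteq> J \<rightarrow>\<^sub>E X" "T \<subseteq> J" "finite T"
    and "\<And>l l'. l \<in> S \<Longrightarrow> l' \<in> S \<Longrightarrow> (\<And>k. k \<in> T \<Longrightarrow> l k = l' k) \<Longrightarrow> l = l'"
  shows "card S \<le> card X ^ card T"
proof -
  have "inj_on (\<lambda>l. restrict l T) S"
  proof (rule inj_onI)
    fix l l' assume "l \<in> S" "l' \<in> S" and eq: "restrict l T = restrict l' T"
    show "l = l'"
      using fun_cong[OF eq] by (intro assms(5) \<open>l \<in> S\<close> \<open>l' \<in> S\<close>) (metis restrict_apply')
  qed
  moreover have "(\<lambda>l. restrict l T) ` S \<subseteq> T \<rightarrow>\<^sub>E X"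
    using assms(2,3) by (fastforce simp: PiE_iff)
  ultimately have "card S \<le> card (T \<rightarrow>\<^sub>E X)"
    using assms by (intro card_inj_on_le) (auto intro: finite_PiE)
  then show ?thesis using assms(4) by (simp add: card_PiE)
qed

text \<open>One position where p and q differ gives one nontrivial equation, which eliminates the
  coordinate \<open>p ! k\<close>.\<close>

lemma card_agreeing_le_cube:
  assumes "finite X" "p \<in> perms4" "q \<in> perms4" "p \<noteq> q"
  shows "card (agreeing X p q) \<le> card X ^ 3"
proof -
  obtain k where k: "k < 4" "p ! k \<noteq> q ! k"
    using assms perms4_D(1) by (metis nth_equalityI)
  have lt: "p ! k < 4" "q ! k < 4" using perms4_D(3) assms k by blast+
  have "card (agreeing X p q) \<le> card X ^ card ({..<4} - {p ! k})"
  proof (rule card_le_if_determined_on[where J = "{..<4}"])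
    fix l l' assume l: "l \<in> agreeing X p q" "l' \<in> agreeing X p q"
      and eq: "\<And>j. j \<in> {..<4} - {p ! k} \<Longrightarrow> l j = l' j"
    have "l (p ! k) = l' (p ! k)"
      using l k lt eq[of "q ! k"] by (auto simp: agreeing_def)
    then show "l = l'"
      using l eq by (intro PiE_ext[of l "{..<4}" "\<lambda>_. X" l']) (auto simp: agreeing_def)
  qed (use assms in \<open>auto simp: agreeing_def\<close>)
  then show ?thesis using lt by simp
qed

text \<open>Two equations l a = l b and l c = l d are wanted that are independent. Three moved
  positions provide them: c can be chosen outside {a, b}, and then the two equations form a forest
  on the coordinates.\<close>

lemma card_agreeing_le_square:
  assumes "finite X" "p \<in> perms4" "q \<in> perms4"
    and moved: "length (filter (\<lambda>k. p ! k \<noteq> q ! k) [0,1,2,3]) \<ge> 3"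
  shows "card (agreeing X p q) \<le> (card X)\<^sup>2"
proof -
  define M where "M = {k. k < 4 \<and> p ! k \<noteq> q ! k}"
  have "M = set (filter (\<lambda>k. p ! k \<noteq> q ! k) [0,1,2,3])"
    unfolding set_filter M_def by (auto simp: less_4_iff)
  then have M: "card M \<ge> 3" "finite M"
    using moved distinct_card[of "filter (\<lambda>k. p ! k \<noteq> q ! k) [0,1,2,3::nat]"] by (simp_all del: filter.simps)
  then obtain k where k: "k \<in> M" by (metis card.empty equals0I not_numeral_le_zero)
  define a b where "a = p ! k" and "b = q ! k"
  \<comment> \<open>By injectivity of p at most two of the moved positions map into {a, b}, so a
    third one is left over.\<close>
  have "card {j \<in> M. p ! j \<in> {a, b}} \<le> card {a, b}"
    using perms4_D(1,2)[OF assms(2)]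
    by (intro card_inj_on_le[where f = "(!) p"]) (auto simp: M_def inj_on_def nth_eq_iff_index_eq)
  also have "\<dots> \<le> 2" by (simp add: card_insert_if)
  finally have "\<not> M \<subseteq> {j \<in> M. p ! j \<in> {a, b}}"
    using M card_mono[of "{j \<in> M. p ! j \<in> {a, b}}" M] by auto
  then obtain j where j: "j \<in> M" "p ! j \<notin> {a, b}" by blast
  define c d where "c = p ! j" and "d = q ! j"
  have lt: "a < 4" "b < 4" "c < 4" "d < 4"
    using k j perms4_D(3) assms by (auto simp: a_def b_def c_def d_def M_def)
  have ne: "a \<noteq> b" "c \<noteq> d" "c \<noteq> a" "c \<noteq> b"
    using k j by (auto simp: a_def b_def c_def d_def M_def)
  have eqs: "l a = l b" "l c = l d" if "l \<in> agreeing X p q" for l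
    using that k j by (auto simp: a_def b_def c_def d_def M_def agreeing_def)
  \<comment> \<open>Of a and b the eliminated coordinate must not be d, because the value at c is
    read off from d.\<close>
  define e where "e = (if d = a then b else a)"
  have e: "e \<noteq> c" "e < 4" using ne lt by (auto simp: e_def)
  have "card (agreeing X p q) \<le> card X ^ card ({..<4} - {e, c})"
  proof (rule card_le_if_determined_on[where J = "{..<4}"])
    fix l l' assume l: "l \<in> agreeing X p q" "l' \<in> agreeing X p q"
      and eq: "\<And>j. j \<in> {..<4} - {e, c} \<Longrightarrow> l j = l' j"
    have "l e = l' e \<and> l c = l' c"
      using eqs[OF l(1)] eqs[OF l(2)] eq[of a] eq[of b] eq[of d] ne lt
      by (cases "d = a") (auto simp: e_def)
    then show "l = l'"
      using l eq by (intro PiE_ext[of l "{..<4}" "\<lambda>_. X" l']) (auto simp: agreeing_def)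
  qed (use assms in \<open>auto simp: agreeing_def\<close>)
  then show ?thesis using e lt by (simp add: card_Diff_subset)
qed

definition colour_dist :: "nat list \<Rightarrow> nat list \<Rightarrow> nat" where
  "colour_dist p q = of_bool (colour0 p \<noteq> colour0 q) + of_bool (colour1 p \<noteq> colour1 q)"

text \<open>In substance \<open>colour_dist\<close> is a lower bound for the Cayley distance. The
  product form avoids division and the count of cycles.\<close>

lemma card_agreeing_colour_dist:
  assumes "finite X" "p \<in> perms4" "q \<in> perms4"
  shows "card (agreeing X p q) * card X ^ colour_dist p q \<le> card X ^ 4"
proof -
  consider "colour_dist p q = 0" | "colour_dist p q = 1" "p \<noteq> q"
    | "colour_dist p q = 2" "colour0 p \<noteq> colour0 q" "colour1 p \<noteq> colour1 q"
    by (cases "colour0 p = colour0 q"; cases "colour1 p = colour1 q") (auto simp: colour_dist_def)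
  then show ?thesis
  proof cases
    case 1
    have "card (agreeing X p q) \<le> card ({..<4::nat} \<rightarrow>\<^sub>E X)"
      using assms(1) by (intro card_mono) (auto simp: agreeing_def intro!: finite_PiE)
    then show ?thesis using 1 by (simp add: card_PiE)
  next
    case 2
    then show ?thesis
      using mult_right_mono[OF card_agreeing_le_cube[OF assms 2(2)], of "card X"]
      by (simp add: power_numeral_reduce mult.commute mult.left_commute)
  next
    case 3
    then have "card (agreeing X p q) \<le> (card X)\<^sup>2"
      using colour_check[rule_format, OF assms(2,3)] assms by (intro card_agreeing_le_square)
    then show ?thesis
      using mult_right_mono[of "card (agreeing X p q)" "(card X)\<^sup>2" "(card X)\<^sup>2"] 3
      by (simp add: power_numeral_reduce mult.assoc)
  qed
qed

text \<open>Two different double transpositions compose to the third one, which has two cycles of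
  length 2. The set {0, \<open>q ! (p ! 0)\<close>} is the cycle through 0, and p, q send the same
  positions into it.\<close>

lemma boundary_perm_pairs:
  "\<forall>p\<in>{[1,0,3,2],[2,3,0,1],[3,2,1,0]}. \<forall>q\<in>{[1,0,3,2],[2,3,0,1],[3,2,1,0::nat]}. p \<noteq> q \<longrightarrow>
    p ! 0 \<notin> {0, q ! (p ! 0)} \<and> list_all (\<lambda>k. p ! k \<in> {0, q ! (p ! 0)} \<longleftrightarrow> q ! k \<in> {0, q ! (p ! 0)}) [0,1,2,3]"
  by code_simp

text \<open>One value on the cycle through 0 and one on its complement may be chosen freely;
  evaluating at 0 and at \<open>p ! 0\<close> recovers the pair.\<close>

lemma card_agreeing_boundary:
  assumes "finite X" "p \<in> {[1,0,3,2],[2,3,0,1],[3,2,1,0]}" "q \<in> {[1,0,3,2],[2,3,0,1],[3,2,1,0]}" "p \<noteq> q"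
  shows "(card X)\<^sup>2 \<le> card (agreeing X p q)"
proof -
  define T where "T = {0, q ! (p ! 0)}"
  have T: "p ! 0 \<notin> T" "list_all (\<lambda>k. p ! k \<in> T \<longleftrightarrow> q ! k \<in> T) [0,1,2,3]"
    using boundary_perm_pairs[THEN bspec, OF assms(2), THEN bspec, OF assms(3), THEN mp, OF assms(4)]
    unfolding T_def by (rule conjunct1, rule conjunct2)
  have T': "p ! k \<in> T \<longleftrightarrow> q ! k \<in> T" if "k < 4" for k
  proof -
    have "k \<in> set [0,1,2,3]" using that by (auto simp: less_4_iff)
    with T(2) show ?thesis unfolding list_all_iff by (rule bspec)
  qed
  have "p \<in> perms4" "q \<in> perms4"
    using assms(2,3) unfolding perms4_eq by (elim insertE emptyE; simp)+
  then have lt: "p ! k < 4" "q ! k < 4" if "k < 4" for k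
    using that by (auto intro: perms4_D(3))
  define f where "f = (\<lambda>(x::'a, y). \<lambda>k\<in>{..<4::nat}. if k \<in> T then x else y)"
  have "inj_on f (X \<times> X)"
  proof (rule inj_onI, clarify)
    fix x y x' y' assume "f (x, y) = f (x', y')"
    then have "f (x, y) k = f (x', y') k" for k by simp
    from this[of 0] this[of "p ! 0"] show "x = x' \<and> y = y'"
      using T(1) lt[of 0] by (simp add: f_def T_def)
  qed
  moreover have "f ` (X \<times> X) \<subseteq> agreeing X p q"
    using T' lt by (auto simp: f_def agreeing_def split: if_splits)
  ultimately have "card (X \<times> X) \<le> card (agreeing X p q)"
    using assms(1) by (intro card_inj_on_le) auto
  then show ?thesis by (simp add: power2_eq_square card_cartesian_product)
qed

section \<open>Permanents and Wick pairings\<close>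

text \<open>Expansion along the first row. The recursive form suits the induction that removes one
  Gaussian factor at a time; it is matched with a sum over \<open>perms4\<close> only for four
  rows.\<close>

fun permanent :: "('a \<Rightarrow> 'b \<Rightarrow> nat) \<Rightarrow> 'a list \<Rightarrow> 'b list \<Rightarrow> nat" where
  "permanent K [] bs = of_bool (bs = [])"
| "permanent K (a # as) bs = (\<Sum>j<length bs. K a (bs ! j) * permanent K as (take j bs @ drop (Suc j) bs))"

abbreviation wick :: "'i list \<Rightarrow> 'i list \<Rightarrow> nat" where
  "wick \<equiv> permanent (\<lambda>a b. of_bool (a = b))"

text \<open>A pairing may only join equal indices, so an index of multiplicity m on both sides
  contributes m! and unequal multiplicities leave no pairing. Hence Gaussian moments are counts of
  permutations.\<close>

lemma wick_eq_prod:
  assumes "finite I" "set as \<subseteq> I" "set bs \<subseteq> I"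
  shows "wick as bs = (\<Prod>i\<in>I. if count_list as i = count_list bs i then fact (count_list as i) else 0)"
  using assms(2,3)
proof (induction as arbitrary: bs)
  case Nil
  show ?case
  proof (cases bs)
    case (Cons b bs')
    then show ?thesis using Nil assms(1) by (auto intro!: prod_zero[symmetric] bexI[of _ b])
  qed simp
next
  case (Cons a as)
  \<comment> \<open>What is left after pairing one copy of a; it is the same for every partner j.
    Truncated subtraction does no harm: if a does not occur in bs, then R is multiplied by
    0.\<close>
  define R where "R = (\<Prod>i\<in>I. if count_list as i = count_list bs i - of_bool (i = a) then fact (count_list as i) else 0 :: nat)"
  have 1: "wick as (take j bs @ drop (Suc j) bs) = R" if j: "j < length bs" "a = bs ! j" for j
  proof -
    have sub: "set (take j bs @ drop (Suc j) bs) \<subseteq> I"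
      using Cons.prems by (auto dest: in_set_takeD in_set_dropD)
    have "count_list (take j bs @ drop (Suc j) bs) i = count_list bs i - of_bool (i = a)" for i
      by (subst (3) id_take_nth_drop[OF j(1)]) (simp add: j(2))
    then show ?thesis
      using Cons.prems unfolding R_def by (subst Cons.IH[OF _ sub]) auto
  qed
  have "wick (a # as) bs = (\<Sum>j<length bs. of_bool (bs ! j = a) * R)"
    unfolding permanent.simps by (intro sum.cong) (auto simp: 1)
  also have "\<dots> = count_list bs a * R"
  proof -
    have "count_list bs a = card {j. j < length bs \<and> bs ! j = a}"
      by (simp add: count_list_eq_length_filter length_filter_conv_card eq_commute)
    moreover have "(\<Sum>j<length bs. of_bool (bs ! j = a)) = card {j. j < length bs \<and> bs ! j = a}"
      by (simp add: Int_def lessThan_def)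
    ultimately show ?thesis by (simp add: sum_distrib_right)
  qed
  also have "\<dots> = (\<Prod>i\<in>I. if count_list (a # as) i = count_list bs i then fact (count_list (a # as) i) else 0)"
  proof -
    have a: "a \<in> I" using Cons.prems by simp
    have "R = (if count_list as a = count_list bs a - 1 then fact (count_list as a) else 0) *
      (\<Prod>i\<in>I-{a}. if count_list as i = count_list bs i then fact (count_list as i) else 0)"
      unfolding R_def by (subst prod.remove[OF assms(1) a]) (auto intro!: prod.cong)
    moreover have "(\<Prod>i\<in>I. if count_list (a # as) i = count_list bs i then fact (count_list (a # as) i) else 0)
      = (if Suc (count_list as a) = count_list bs a then fact (Suc (count_list as a)) else 0) *
      (\<Prod>i\<in>I-{a}. if count_list as i = count_list bs i then fact (count_list as i) else 0 :: nat)"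
      by (subst prod.remove[OF assms(1) a], intro arg_cong2[where f = "(*)"] prod.cong refl) auto
    ultimately show ?thesis by (cases "count_list bs a") (auto simp: algebra_simps)
  qed
  finally show ?case .
qed

lemma lessThan_4: "{..<4::nat} = {0,1,2,3}"
  by (auto simp: less_4_iff)

lemma permanent4:
  "permanent K [y 0, y 1, y 2, y 3] [x 0, x 1, x 2, x 3] = (\<Sum>p\<in>perms4. \<Prod>k<4. K (y k) (x (p ! k)))"
proof -
  have 1: "(\<Prod>k<4. K (y k) (x (p ! k))) = K (y 0) (x (p ! 0)) * (K (y 1) (x (p ! 1)) *
      (K (y 2) (x (p ! 2)) * K (y 3) (x (p ! 3))))" for p
    by (simp add: lessThan_4)
  \<comment> \<open>Lexicographic order is the order in which the expansion along rows produces its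
    terms, so the flattened sums agree term by term.\<close>
  define L :: "nat list list" where L: "L = [[0,1,2,3],[0,1,3,2],[0,2,1,3],[0,2,3,1],[0,3,1,2],[0,3,2,1],
  [1,0,2,3],[1,0,3,2],[1,2,0,3],[1,2,3,0],[1,3,0,2],[1,3,2,0],
  [2,0,1,3],[2,0,3,1],[2,1,0,3],[2,1,3,0],[2,3,0,1],[2,3,1,0],
  [3,0,1,2],[3,0,2,1],[3,1,0,2],[3,1,2,0],[3,2,0,1],[3,2,1,0]]"
  have p1: "permanent K [a] [b] = K a b" for a b
    by simp
  have p2: "permanent K [a, a'] [b, b'] = K a b * K a' b' + K a b' * K a' b" for a a' b b'
    by (subst permanent.simps(2)) (simp add: p1 del: permanent.simps)
  have p3: "permanent K [a, a', a''] [b, b', b''] = K a b * permanent K [a', a''] [b', b'']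
      + K a b' * permanent K [a', a''] [b, b''] + K a b'' * permanent K [a', a''] [b, b']" for a a' a'' b b' b''
    by (subst permanent.simps(2)) (simp del: permanent.simps)
  have 2: "permanent K [a0, a1, a2, a3] [b0, b1, b2, b3] =
     (\<Sum>p\<leftarrow>L. K a0 ([b0, b1, b2, b3] ! (p ! 0)) * (K a1 ([b0, b1, b2, b3] ! (p ! 1)) *
      (K a2 ([b0, b1, b2, b3] ! (p ! 2)) * K a3 ([b0, b1, b2, b3] ! (p ! 3)))))" for a0 a1 a2 a3 b0 b1 b2 b3
    unfolding L by (subst permanent.simps(2)) (simp add: p2 p3 distrib_left del: permanent.simps)
  have dist: "distinct L"
    unfolding L by simp
  have set_L: "perms4 = set L"
    unfolding L perms4_eq by simp
  have "(\<Sum>p\<in>perms4. \<Prod>k<4. K (y k) (x (p ! k))) = (\<Sum>p\<leftarrow>L. \<Prod>k<4. K (y k) (x (p ! k)))"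
    unfolding set_L by (rule sum.distinct_set_conv_list[OF dist])
  also have "\<dots> = permanent K [y 0, y 1, y 2, y 3] [x 0, x 1, x 2, x 3]"
    unfolding 1 2 unfolding L by (simp del: permanent.simps)
  finally show ?thesis ..
qed

subsection \<open>Four-point functions of the Haar measure\<close>

lemma finite_perms4 [simp]: "finite perms4"
  by (simp add: perms4_def)

lemma sum_of_bool_card:
  "finite A \<Longrightarrow> (\<Sum>x\<in>A. of_bool (P x)) = card {x \<in> A. P x}"
  by (simp add: Int_def)

lemma wick4:
  "wick [y 0, y 1, y 2, y 3] [x 0, x 1, x 2, x 3] = card {p \<in> perms4. \<forall>k<4. y k = x (p ! k)}"
  unfolding permanent4 sum_of_bool_card[OF finite_perms4, symmetric]
  by (intro sum.cong refl) (auto simp: lessThan_4 less_4_iff)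

lemma prod_power_count_list:
  fixes f :: "'i \<Rightarrow> 'b :: comm_monoid_mult"
  assumes "finite I" "set as \<subseteq> I"
  shows "(\<Prod>i\<in>I. f i ^ count_list as i) = prod_list (map f as)"
  using assms(2)
proof (induction as)
  case (Cons a as)
  have "(\<Prod>i\<in>I. f i ^ count_list (a # as) i) = (\<Prod>i\<in>I. (if a = i then f i else 1) * f i ^ count_list as i)"
    by (intro prod.cong) auto
  also have "\<dots> = f a * prod_list (map f as)"
    using Cons assms(1) by (simp add: prod.distrib prod.delta)
  finally show ?case by simp
qed simp

lemma mixed_monomial_four_point:
  fixes x y :: "nat \<Rightarrow> 'i"
  assumes "finite I" "\<And>k. k < 4 \<Longrightarrow> x k \<in> I" "\<And>k. k < 4 \<Longrightarrow> y k \<in> I"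
  shows "(\<lambda>\<psi>. (\<Prod>k<4. \<psi> (y k)) * (\<Prod>k<4. cnj (\<psi> (x k))))
    = mixed_monomial I (count_list [y 0, y 1, y 2, y 3]) (count_list [x 0, x 1, x 2, x 3])"
proof
  fix \<psi> :: "'i \<Rightarrow> complex"
  have "(\<Prod>k<4. f (z k)) = prod_list (map f [z 0, z 1, z 2, z 3])" for f :: "'i \<Rightarrow> complex" and z :: "nat \<Rightarrow> 'i"
    by (simp add: lessThan_4 mult.assoc)
  from this[of \<psi> y] this[of "\<lambda>i. cnj (\<psi> i)" x]
  show "(\<Prod>k<4. \<psi> (y k)) * (\<Prod>k<4. cnj (\<psi> (x k)))
    = mixed_monomial I (count_list [y 0, y 1, y 2, y 3]) (count_list [x 0, x 1, x 2, x 3]) \<psi>"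
    using assms unfolding prod.distrib by (subst (1 2) prod_power_count_list) auto
qed

text \<open>Only the zero vector fails to be normalised, and already a single Gaussian coordinate is
  almost surely nonzero.\<close>

lemma AE_haar_sphere_norm:
  assumes "finite I" "I \<noteq> {}"
  shows "AE \<psi> in haar_sphere I. sqnorm_on I \<psi> = 1"
proof -
  obtain i where i: "i \<in> I" using assms by blast
  have "AE z in cgauss. z \<noteq> 0"
    unfolding cgauss_def by (subst AE_density) (auto intro: eventually_mono[OF AE_lborel_singleton])
  then have "AE z in PiM I (\<lambda>_. cgauss). z i \<noteq> 0"
    by (intro AE_PiM_component[of I "\<lambda>_. cgauss" i] prob_space_cgauss i)
  then have "AE z in PiM I (\<lambda>_. cgauss).
     sqnorm_on I (restrict (\<lambda>i. z i / complex_of_real (sqrt (sqnorm_on I z))) I) = 1"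
  proof eventually_elim
    case (elim z)
    have "(cmod (z i))\<^sup>2 \<le> sqnorm_on I z"
      using assms i by (intro member_le_sum) auto
    moreover have "0 < (cmod (z i))\<^sup>2" using elim by simp
    ultimately have pos: "sqnorm_on I z > 0" by linarith
    have "sqnorm_on I (restrict (\<lambda>i. z i / complex_of_real (sqrt (sqnorm_on I z))) I)
       = (\<Sum>i\<in>I. (cmod (z i))\<^sup>2 / sqnorm_on I z)"
      using pos by (intro sum.cong) (auto simp: norm_divide power_divide)
    also have "\<dots> = 1"
      using pos by (simp add: sum_divide_distrib[symmetric])
    finally show ?case .
  qed
  then show ?thesis
    unfolding haar_sphere_def by (subst AE_distr_iff) (auto; measurable)+
qed

text \<open>With d = \<open>card I\<close> this is the rising factorial d(d+1)(d+2)(d+3), or 24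
  times the dimension of the symmetric subspace of four copies of C^I.\<close>

definition fixed_point_sum :: "'i set \<Rightarrow> nat" where
  "fixed_point_sum I = (\<Sum>p\<in>perms4. card (agreeing I [0,1,2,3] p))"

lemma integrable_haar_four_point:
  fixes x y :: "nat \<Rightarrow> 'i"
  assumes "finite I" "\<And>k. k < 4 \<Longrightarrow> x k \<in> I" "\<And>k. k < 4 \<Longrightarrow> y k \<in> I"
  shows "integrable (haar_sphere I) (\<lambda>\<psi>. (\<Prod>k<4. \<psi> (y k)) * (\<Prod>k<4. cnj (\<psi> (x k))))"
  by (subst mixed_monomial_four_point[of I x y, OF assms]) (auto intro: integrable_haar_sphere_monomial assms)

text \<open>Double counting of pairs of an index function and a permutation that fixes it, as in
  Burnside's lemma.\<close>

lemma sum_card_fixed_points: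
  fixes I :: "'i set"
  assumes "finite I"
  shows "(\<Sum>x\<in>{..<4} \<rightarrow>\<^sub>E I. card {p \<in> perms4. \<forall>k<4. x k = x (p ! k)}) = fixed_point_sum I"
proof -
  let ?P = "\<lambda>(x :: nat \<Rightarrow> 'i) p. \<forall>k<4. x k = x (p ! k)"
  let ?X = "{..<4::nat} \<rightarrow>\<^sub>E I"
  have fin: "finite ?X" using assms by (intro finite_PiE) auto
  have 1: "agreeing I [0,1,2,3] p = {x \<in> ?X. ?P x p}" for p
    unfolding agreeing_def by (simp add: less_4_iff)
  have "(\<Sum>x\<in>?X. card {p \<in> perms4. ?P x p}) = (\<Sum>x\<in>?X. \<Sum>p\<in>perms4. of_bool (?P x p))"
    by (simp only: sum_of_bool_card[OF finite_perms4])
  then have "(\<Sum>x\<in>?X. card {p \<in> perms4. ?P x p}) = (\<Sum>p\<in>perms4. \<Sum>x\<in>?X. of_bool (?P x p))"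
    by (simp only: sum.swap[of _ perms4 ?X])
  then show ?thesis
    by (simp only: sum_of_bool_card[OF fin] fixed_point_sum_def 1)
qed

text \<open>The proportionality constant between Haar and Gaussian moments is determined by
  \<open>E[|\<psi>|^8] = 1\<close>; no explicit value of the rational function of the dimension is needed.\<close>
lemma haar_four_point:
  fixes x y :: "nat \<Rightarrow> 'i"
  assumes "finite I" "I \<noteq> {}"
    and "\<And>k. k < 4 \<Longrightarrow> x k \<in> I" "\<And>k. k < 4 \<Longrightarrow> y k \<in> I"
  shows "integral\<^sup>L (haar_sphere I) (\<lambda>\<psi>. (\<Prod>k<4. \<psi> (y k)) * (\<Prod>k<4. cnj (\<psi> (x k))))
    = complex_of_real (card {p \<in> perms4. \<forall>k<4. y k = x (p ! k)} / fixed_point_sum I)"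
proof -
  interpret prob_space "haar_sphere I" by (rule prob_space_haar_sphere)
  obtain \<kappa> :: real where \<kappa>: "\<And>\<alpha> \<beta>. sum \<alpha> I = Suc 3 \<Longrightarrow> sum \<beta> I = Suc 3 \<Longrightarrow>
     integral\<^sup>L (haar_sphere I) (mixed_monomial I \<alpha> \<beta>) = complex_of_real (\<kappa> * gauss_moment I \<alpha> \<beta>)"
    using haar_sphere_moments[OF assms(1), of 3] by blast
  have moment: "integral\<^sup>L (haar_sphere I) (\<lambda>\<psi>. (\<Prod>k<4. \<psi> (y k)) * (\<Prod>k<4. cnj (\<psi> (x k))))
    = complex_of_real (\<kappa> * card {p \<in> perms4. \<forall>k<4. y k = x (p ! k)})"
    if xy: "\<And>k. k < 4 \<Longrightarrow> x k \<in> I" "\<And>k. k < 4 \<Longrightarrow> y k \<in> I" for x y :: "nat \<Rightarrow> 'i"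
  proof -
    have sub: "set [x 0, x 1, x 2, x 3] \<subseteq> I" "set [y 0, y 1, y 2, y 3] \<subseteq> I"
      using xy by auto
    show ?thesis
      unfolding wick4[symmetric] wick_eq_prod[OF assms(1) sub(2,1)]
    proof (subst mixed_monomial_four_point[of I x y, OF assms(1) xy])
      have "sum (count_list [x 0, x 1, x 2, x 3]) I = 4" "sum (count_list [y 0, y 1, y 2, y 3]) I = 4"
        using sum_count_set[OF sub(1) assms(1)] sum_count_set[OF sub(2) assms(1)] by simp_all
      then show "expectation (mixed_monomial I (count_list [y 0, y 1, y 2, y 3]) (count_list [x 0, x 1, x 2, x 3]))
        = complex_of_real (\<kappa> * gauss_moment I (count_list [y 0, y 1, y 2, y 3]) (count_list [x 0, x 1, x 2, x 3]))"
        by (intro \<kappa>) simp_all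
    qed
  qed
  let ?X = "{..<4::nat} \<rightarrow>\<^sub>E I"
  have "complex_of_real (\<kappa> * fixed_point_sum I)
      = (\<Sum>x\<in>?X. complex_of_real (\<kappa> * card {p \<in> perms4. \<forall>k<4. x k = x (p ! k)}))"
  proof -
    have "(\<Sum>x\<in>?X. card {p \<in> perms4. \<forall>k<4. x k = x (p ! k)}) = fixed_point_sum I"
      by (rule sum_card_fixed_points[OF assms(1)])
    then have "real (fixed_point_sum I) = (\<Sum>x\<in>?X. real (card {p \<in> perms4. \<forall>k<4. x k = x (p ! k)}))"
      by (simp only: of_nat_sum[symmetric])
    then show ?thesis
      by (simp add: sum_distrib_left)
  qed
  also have "\<dots> = (\<Sum>x\<in>?X. integral\<^sup>L (haar_sphere I) (\<lambda>\<psi>. (\<Prod>k<4. \<psi> (x k)) * (\<Prod>k<4. cnj (\<psi> (x k)))))"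
    by (intro sum.cong refl moment[symmetric]) (auto simp: PiE_iff)
  also have "\<dots> = integral\<^sup>L (haar_sphere I) (\<lambda>\<psi>. \<Sum>x\<in>?X. (\<Prod>k<4. \<psi> (x k)) * (\<Prod>k<4. cnj (\<psi> (x k))))"
    using assms(1)
    by (intro Bochner_Integration.integral_sum[symmetric] integrable_haar_four_point) (auto simp: PiE_iff)
  also have "(\<lambda>\<psi>. \<Sum>x\<in>?X. (\<Prod>k<4. \<psi> (x k)) * (\<Prod>k<4. cnj (\<psi> (x k))))
      = (\<lambda>\<psi>. complex_of_real (sqnorm_on I \<psi> ^ 4))"
  proof
    fix \<psi> :: "'i \<Rightarrow> complex"
    have "complex_of_real (sqnorm_on I \<psi> ^ 4) = (\<Prod>k<4::nat. \<Sum>i\<in>I. \<psi> i * cnj (\<psi> i))"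
      by (simp only: of_real_power of_real_sum prod_constant card_lessThan complex_norm_square[unfolded of_real_power])
    also have "\<dots> = (\<Sum>x\<in>?X. \<Prod>k<4. \<psi> (x k) * cnj (\<psi> (x k)))"
      using assms(1) by (intro prod_sum_PiE) auto
    finally show "(\<Sum>x\<in>?X. (\<Prod>k<4. \<psi> (x k)) * (\<Prod>k<4. cnj (\<psi> (x k)))) = complex_of_real (sqnorm_on I \<psi> ^ 4)"
      by (simp add: prod.distrib)
  qed
  also have "integral\<^sup>L (haar_sphere I) (\<lambda>\<psi>. complex_of_real (sqnorm_on I \<psi> ^ 4)) = (\<integral>\<psi>. 1 \<partial>haar_sphere I)"
  proof (rule integral_cong_AE)
    show "AE \<psi> in haar_sphere I. complex_of_real (sqnorm_on I \<psi> ^ 4) = 1"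
      using AE_haar_sphere_norm[OF assms(1,2)] by eventually_elim simp
  qed measurable
  also have "\<dots> = 1" by (simp add: prob_space)
  finally have "\<kappa> * fixed_point_sum I = 1"
    by (metis of_real_eq_1_iff)
  then have "\<kappa> = 1 / fixed_point_sum I"
    by (metis nonzero_eq_divide_eq mult_zero_right zero_neq_one)
  then show ?thesis
    using moment[of x y] assms(3,4) by simp
qed

text \<open>The identity contributes the fourth power, and each of the 23 other permutations imposes
  at least one equation.\<close>

lemma fixed_point_sum_bounds:
  assumes "finite I"
  shows "card I ^ 4 \<le> fixed_point_sum I" "fixed_point_sum I \<le> card I ^ 4 + 23 * card I ^ 3"
proof -
  have id: "[0,1,2,3] \<in> perms4" by (simp add: perms4_eq)
  have "fixed_point_sum I = card I ^ 4 + (\<Sum>p\<in>perms4-{[0,1,2,3]}. card (agreeing I [0,1,2,3] p))"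
    unfolding fixed_point_sum_def by (subst sum.remove[OF finite_perms4 id]) (simp add: card_agreeing_self)
  moreover have "(\<Sum>p\<in>perms4-{[0,1,2,3]}. card (agreeing I [0,1,2,3] p)) \<le> card (perms4-{[0,1,2,3]}) * card I ^ 3"
    using card_agreeing_le_cube[OF assms id] by (intro sum_bounded_above[where 'a = nat, simplified]) auto
  moreover have "card (perms4-{[0,1,2,3]}) = 23"
    by (simp add: perms4_eq)
  ultimately show "card I ^ 4 \<le> fixed_point_sum I" "fixed_point_sum I \<le> card I ^ 4 + 23 * card I ^ 3"
    by simp_all
qed

subsection \<open>The network as a spin model\<close>

lemma prod_of_bool: "finite A \<Longrightarrow> (\<Prod>x\<in>A. of_bool (P x)) = (of_bool (\<forall>x\<in>A. P x) :: 'b :: comm_semiring_1)"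
  by (induction A rule: finite_induct) auto

lemma prod_of_bool4: "(\<Prod>k<4::nat. of_bool (P k)) = (of_bool (\<forall>k<4. P k) :: 'b :: comm_semiring_1)"
  by (auto simp: prod_of_bool)

locale tripartite_network =
  fixes V Vb A B C :: "'v set" and E :: "'e set" and ends :: "'e \<Rightarrow> 'v set"
  assumes finite_V: "finite V" and finite_E: "finite E"
    and ends: "\<And>e. e \<in> E \<Longrightarrow> ends e \<subseteq> V" "\<And>e. e \<in> E \<Longrightarrow> card (ends e) = 2"
    and V_eq: "V = (A \<union> B \<union> C) \<union> Vb" and disj: "(A \<union> B \<union> C) \<inter> Vb = {}"
    and ABC_disj: "A \<inter> B = {}" "A \<inter> C = {}" "B \<inter> C = {}"
begin

abbreviation "Vp \<equiv> A \<union> B \<union> C"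
abbreviation "local_label l v \<equiv> restrict l (incident E ends v)"
abbreviation "edge_labels D \<equiv> E \<rightarrow>\<^sub>E {..<D::nat}"
abbreviation "replicas D \<equiv> {..<4::nat} \<rightarrow>\<^sub>E edge_labels D"

text \<open>The double transpositions (12)(34), (13)(24), (14)(23) on copies numbered from 0. The
  last branch also gives vertices off the boundary a value in \<open>perms4\<close>.\<close>

definition boundary_perm :: "'v \<Rightarrow> nat list" where
  "boundary_perm v = (if v \<in> A then [1,0,3,2] else if v \<in> B then [2,3,0,1] else [3,2,1,0])"

text \<open>L holds the edge labels of the four ket copies and M those of the four conjugated
  copies; a spin p at v glues copy k of M to copy \<open>p ! k\<close> of L.\<close>

definition matching :: "'v \<Rightarrow> nat list \<Rightarrow> (nat \<Rightarrow> 'e \<Rightarrow> nat) \<Rightarrow> (nat \<Rightarrow> 'e \<Rightarrow> nat) \<Rightarrow> bool" where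
  "matching v p L M \<longleftrightarrow> (\<forall>k<4. local_label (M k) v = local_label (L (p ! k)) v)"

definition consistent :: "('e \<Rightarrow> nat) \<Rightarrow> ('v \<Rightarrow> 'e \<Rightarrow> nat) \<Rightarrow> bool" where
  "consistent l x \<longleftrightarrow> (\<forall>v\<in>Vp. \<forall>e\<in>incident E ends v. l e = x v e)"

lemma finite_sets: "finite Vp" "finite Vb" "finite (incident E ends v)"
  using finite_V finite_E V_eq by (auto simp: incident_def)

lemma finite_edge_labels: "finite (edge_labels D)" "finite (replicas D)"
  using finite_E by (auto intro!: finite_PiE)

lemma at_in_labels: "l \<in> edge_labels D \<Longrightarrow> local_label l v \<in> labels E ends D v"
  by (auto simp: labels_def incident_def PiE_iff)

lemma finite_labels: "finite (labels E ends D v)"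
  unfolding labels_def by (intro finite_PiE finite_sets) auto

lemma card_labels: "card (labels E ends D v) = D ^ deg E ends v"
  using finite_sets(3)[of v] by (simp add: labels_def deg_def card_PiE)

lemma labels_nonempty: "D > 0 \<Longrightarrow> labels E ends D v \<noteq> {}"
  by (auto simp: labels_def PiE_eq_empty_iff)

lemma finite_bbasis: "finite (bbasis E ends D Vp)"
  unfolding bbasis_def by (intro finite_PiE finite_sets finite_labels)

lemma consistent_iff_at:
  assumes "x \<in> bbasis E ends D Vp"
  shows "consistent l x \<longleftrightarrow> (\<forall>v\<in>Vp. local_label l v = x v)"
proof -
  have "(\<forall>e\<in>incident E ends v. l e = x v e) \<longleftrightarrow> local_label l v = x v" if "v \<in> Vp" for v
  proof -
    have "x v \<in> extensional (incident E ends v)"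
      using assms that by (auto simp: bbasis_def labels_def PiE_iff)
    then show ?thesis
      by (auto simp: fun_eq_iff extensional_def restrict_def)
  qed
  then show ?thesis by (simp add: consistent_def)
qed

lemma boundary_perm_pi:
  "v \<in> Vp \<Longrightarrow> twist A B C y k v = y (boundary_perm v ! k) v"
  using ABC_disj by (auto simp: twist_def boundary_perm_def pi1_def pi2_def pi3_def)

lemma boundary_perm_in_perms4: "boundary_perm v \<in> perms4"
  by (simp add: boundary_perm_def perms4_eq)

lemma twist_in_bbasis:
  assumes "y \<in> {..<4} \<rightarrow>\<^sub>E bbasis E ends D Vp" "k < 4"
  shows "twist A B C y k \<in> bbasis E ends D Vp"
proof -
  have y: "y j \<in> bbasis E ends D Vp" if "j < 4" for j using assms(1) that by auto
  show ?thesis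
    unfolding bbasis_def
  proof (rule PiE_I)
    fix v assume v: "v \<in> Vp"
    then show "twist A B C y k v \<in> labels E ends D v"
      using y[of "boundary_perm v ! k"] perms4_D(3)[OF boundary_perm_in_perms4 assms(2), of v]
      by (simp add: boundary_perm_pi bbasis_def PiE_iff)
  next
    fix v assume v: "v \<notin> Vp"
    then show "twist A B C y k v = undefined"
      using y[OF assms(2)] by (auto simp: twist_def bbasis_def PiE_iff extensional_def)
  qed
qed

text \<open>The ket labels determine the boundary basis vectors, so the sum over y has one surviving
  term. In that term the twisted bra condition becomes the gluing by the boundary spins.\<close>

lemma sum_boundary_labels:
  assumes L: "L \<in> replicas D" and M: "M \<in> replicas D"
  shows "(\<Sum>y\<in>{..<4} \<rightarrow>\<^sub>E bbasis E ends D Vp.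
      (\<Prod>k<4. of_bool (consistent (M k) (twist A B C y k))) * (\<Prod>k<4. of_bool (consistent (L k) (y k))))
    = (\<Prod>v\<in>Vp. of_bool (matching v (boundary_perm v) L M) :: complex)"
proof -
  let ?Y = "{..<4::nat} \<rightarrow>\<^sub>E bbasis E ends D Vp"
  define y0 where "y0 = (\<lambda>k\<in>{..<4::nat}. \<lambda>v\<in>Vp. local_label (L k) v)"
  have L': "L k \<in> edge_labels D" if "k < 4" for k using L that by auto
  have y0: "y0 \<in> ?Y"
    using at_in_labels[OF L'] by (auto simp: y0_def bbasis_def)
  have 1: "(\<forall>k<4. consistent (L k) (y k)) \<longleftrightarrow> y = y0" if y: "y \<in> ?Y" for y
  proof
    assume *: "\<forall>k<4. consistent (L k) (y k)"
    show "y = y0"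
    proof (rule PiE_ext[OF y y0])
      fix k assume k: "k \<in> {..<4::nat}"
      then have yk: "y k \<in> bbasis E ends D Vp" using y by auto
      show "y k = y0 k"
      proof (rule PiE_ext[OF yk[unfolded bbasis_def]])
        show "y0 k \<in> Pi\<^sub>E Vp (labels E ends D)" using y0 k by (auto simp: bbasis_def)
        fix v assume v: "v \<in> Vp"
        have "consistent (L k) (y k)" using * k by simp
        then have "local_label (L k) v = y k v"
          using v unfolding consistent_iff_at[OF yk] by (rule bspec)
        then show "y k v = y0 k v"
          using k v by (simp add: y0_def)
      qed
    qed
  next
    assume "y = y0"
    moreover have "consistent (L k) (y0 k)" if "k < 4" for k
      using that by (auto simp: consistent_def y0_def)
    ultimately show "\<forall>k<4. consistent (L k) (y k)" by simp
  qed
  have y0_at: "y0 k v = local_label (L k) v" if "k < 4" "v \<in> Vp" for k v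
    unfolding y0_def using that by simp
  have 2: "(\<forall>k<4. consistent (M k) (twist A B C y0 k)) \<longleftrightarrow> (\<forall>v\<in>Vp. matching v (boundary_perm v) L M)"
  proof -
    have "consistent (M k) (twist A B C y0 k) \<longleftrightarrow> (\<forall>v\<in>Vp. local_label (M k) v = local_label (L (boundary_perm v ! k)) v)" if "k < 4" for k
      unfolding consistent_iff_at[OF twist_in_bbasis[OF y0 that]]
      using perms4_D(3)[OF boundary_perm_in_perms4 that] by (intro ball_cong refl) (simp only: boundary_perm_pi y0_at)
    then show ?thesis by (auto simp: matching_def)
  qed
  have "(\<Sum>y\<in>?Y. (\<Prod>k<4. of_bool (consistent (M k) (twist A B C y k))) * (\<Prod>k<4. of_bool (consistent (L k) (y k))) :: complex)
     = (\<Sum>y\<in>?Y. if y = y0 then of_bool (\<forall>v\<in>Vp. matching v (boundary_perm v) L M) else 0)"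
  proof (rule sum.cong[OF refl])
    fix y assume y: "y \<in> ?Y"
    show "(\<Prod>k<4. of_bool (consistent (M k) (twist A B C y k))) * (\<Prod>k<4. of_bool (consistent (L k) (y k)))
      = (if y = y0 then of_bool (\<forall>v\<in>Vp. matching v (boundary_perm v) L M) else 0 :: complex)"
    proof (cases "y = y0")
      case True
      then show ?thesis
        unfolding prod_of_bool4 1[OF y] unfolding True 2 by simp
    next
      case False
      then show ?thesis
        unfolding prod_of_bool4 1[OF y] by simp
    qed
  qed
  also have "\<dots> = of_bool (\<forall>v\<in>Vp. matching v (boundary_perm v) L M)"
    using y0 by (simp add: finite_PiE finite_bbasis)
  also have "\<dots> = (\<Prod>v\<in>Vp. of_bool (matching v (boundary_perm v) L M))"
    using finite_sets(1) by (simp add: prod_of_bool)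
  finally show ?thesis .
qed

definition replica_weight :: "nat \<Rightarrow> complex" where
  "replica_weight D = (complex_of_real (real D powr (- real (card E) / 2)) *
     (\<Prod>v\<in>Vb. complex_of_real (real D powr (real (deg E ends v) / 2)))) ^ 4"

lemma prod_rtn_state:
  "(\<Prod>k<4. rtn_state E ends Vp Vb D psi (x k)) =
     (\<Sum>L\<in>replicas D. (\<Prod>k<4. of_bool (consistent (L k) (x k))) * (replica_weight D *
        (\<Prod>v\<in>Vb. \<Prod>k<4. cnj (psi v (local_label (L k) v)))))"
proof -
  have "(\<Prod>k<4. rtn_state E ends Vp Vb D psi (x k)) =
    (\<Sum>L\<in>replicas D. \<Prod>k<4. of_bool (consistent (L k) (x k)) *
        complex_of_real (real D powr (- real (card E) / 2)) *
        (\<Prod>v\<in>Vb. complex_of_real (real D powr (real (deg E ends v) / 2)) * cnj (psi v (local_label (L k) v))))"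
    unfolding rtn_state_def consistent_def of_bool_def
    by (rule prod_sum_PiE) (auto intro: finite_edge_labels)
  also have "\<dots> = (\<Sum>L\<in>replicas D. (\<Prod>k<4. of_bool (consistent (L k) (x k))) * (replica_weight D *
        (\<Prod>v\<in>Vb. \<Prod>k<4. cnj (psi v (local_label (L k) v)))))"
  proof (rule sum.cong[OF refl])
    fix L
    have swap: "(\<Prod>k<4::nat. \<Prod>v\<in>Vb. cnj (psi v (local_label (L k) v)))
        = (\<Prod>v\<in>Vb. \<Prod>k<4. cnj (psi v (local_label (L k) v)))"
      by (rule prod.swap)
    show "(\<Prod>k<4. of_bool (consistent (L k) (x k)) *
        complex_of_real (real D powr (- real (card E) / 2)) *
        (\<Prod>v\<in>Vb. complex_of_real (real D powr (real (deg E ends v) / 2)) * cnj (psi v (local_label (L k) v))))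
      = (\<Prod>k<4. of_bool (consistent (L k) (x k))) * (replica_weight D *
        (\<Prod>v\<in>Vb. \<Prod>k<4. cnj (psi v (local_label (L k) v))))"
      unfolding replica_weight_def
      by (simp only: prod.distrib prod_constant card_lessThan swap power_mult_distrib mult.assoc)
  qed
  finally show ?thesis .
qed

lemma replica_weight_real: "cnj (replica_weight D) = replica_weight D"
  by (simp add: replica_weight_def)

text \<open>Four kets and four bras raise each square root of D to the eighth power, so only integer
  exponents remain.\<close>

lemma replica_weight_square:
  assumes "D > 0"
  shows "(replica_weight D)\<^sup>2 = complex_of_real ((\<Prod>v\<in>Vb. real D ^ (4 * deg E ends v)) / real D ^ (4 * card E))"
proof -
  have 1: "(real D powr (real n / 2)) ^ 8 = real D ^ (4 * n)" for n
  proof -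
    have "(real D powr (real n / 2)) ^ 8 = real D powr real (4 * n)"
      using assms by (simp add: powr_power)
    also have "\<dots> = real D ^ (4 * n)"
      using assms by (intro powr_realpow) simp
    finally show ?thesis .
  qed
  have 2: "(real D powr (- real n / 2)) ^ 8 = 1 / real D ^ (4 * n)" for n
    using assms 1[of n] by (simp add: powr_minus inverse_eq_divide power_divide)
  have "replica_weight D ^ 2 = complex_of_real (real D powr (- real (card E) / 2)) ^ 8 *
     (\<Prod>v\<in>Vb. complex_of_real (real D powr (real (deg E ends v) / 2)) ^ 8)"
    unfolding replica_weight_def by (simp add: power_mult_distrib prod_power_distrib flip: power_mult)
  also have "\<dots> = complex_of_real ((real D powr (- real (card E) / 2)) ^ 8 * (\<Prod>v\<in>Vb. (real D powr (real (deg E ends v) / 2)) ^ 8))"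
    by simp
  also have "\<dots> = complex_of_real ((\<Prod>v\<in>Vb. real D ^ (4 * deg E ends v)) / real D ^ (4 * card E))"
    unfolding 1 2 by simp
  finally show ?thesis .
qed

text \<open>Summing over y before averaging leaves a random part that is a product over bulk
  vertices, ready for independence.\<close>

lemma swap_moment_expand:
  "swap_moment E ends Vb A B C D psi =
    (\<Sum>M\<in>replicas D. \<Sum>L\<in>replicas D. (\<Prod>v\<in>Vp. of_bool (matching v (boundary_perm v) L M)) *
       ((replica_weight D)\<^sup>2 * (\<Prod>v\<in>Vb. (\<Prod>k<4. psi v (local_label (M k) v)) * (\<Prod>k<4. cnj (psi v (local_label (L k) v))))))"
proof -
  let ?t = "\<lambda>y M. (\<Prod>k<4. of_bool (consistent (M k) (twist A B C y k))) :: complex"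
  let ?c = "\<lambda>y L. (\<Prod>k<4. of_bool (consistent (L k) (y k))) :: complex"
  let ?p = "\<lambda>M L. (replica_weight D)\<^sup>2 * (\<Prod>v\<in>Vb. (\<Prod>k<4. psi v (local_label (M k) v)) * (\<Prod>k<4. cnj (psi v (local_label (L k) v))))"
  let ?Y = "{..<4::nat} \<rightarrow>\<^sub>E bbasis E ends D Vp"
  have "swap_moment E ends Vb A B C D psi =
     (\<Sum>y\<in>?Y. \<Sum>M\<in>replicas D. \<Sum>L\<in>replicas D. (?t y M * ?c y L) * ?p M L)"
    unfolding swap_moment_def
  proof (rule sum.cong[OF refl])
    fix y
    have "cnj (\<Prod>k<4. rtn_state E ends Vp Vb D psi (twist A B C y k)) =
      (\<Sum>M\<in>replicas D. ?t y M * (replica_weight D * (\<Prod>v\<in>Vb. \<Prod>k<4. psi v (local_label (M k) v))))"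
    proof -
      have "cnj (of_bool P) = of_bool P" for P by (cases P) auto
      then show ?thesis unfolding prod_rtn_state by (simp add: replica_weight_real)
    qed
    moreover have "(\<Prod>k<4. rtn_state E ends Vp Vb D psi (y k)) =
      (\<Sum>L\<in>replicas D. ?c y L * (replica_weight D * (\<Prod>v\<in>Vb. \<Prod>k<4. cnj (psi v (local_label (L k) v)))))"
      by (rule prod_rtn_state)
    ultimately have "cnj (\<Prod>k<4. rtn_state E ends Vp Vb D psi (twist A B C y k)) * (\<Prod>k<4. rtn_state E ends Vp Vb D psi (y k))
        = (\<Sum>M\<in>replicas D. \<Sum>L\<in>replicas D.
            (?t y M * (replica_weight D * (\<Prod>v\<in>Vb. \<Prod>k<4. psi v (local_label (M k) v)))) *
            (?c y L * (replica_weight D * (\<Prod>v\<in>Vb. \<Prod>k<4. cnj (psi v (local_label (L k) v))))))"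
      by (simp only: sum_product)
    also have "\<dots> = (\<Sum>M\<in>replicas D. \<Sum>L\<in>replicas D. (?t y M * ?c y L) * ?p M L)"
      by (intro sum.cong refl) (simp add: prod.distrib power2_eq_square mult_ac)
    finally show "cnj (\<Prod>k<4. rtn_state E ends Vp Vb D psi (twist A B C y k)) * (\<Prod>k<4. rtn_state E ends Vp Vb D psi (y k))
        = (\<Sum>M\<in>replicas D. \<Sum>L\<in>replicas D. (?t y M * ?c y L) * ?p M L)" .
  qed
  also have "\<dots> = (\<Sum>M\<in>replicas D. \<Sum>y\<in>?Y. \<Sum>L\<in>replicas D. (?t y M * ?c y L) * ?p M L)"
    by (rule sum.swap)
  also have "\<dots> = (\<Sum>M\<in>replicas D. \<Sum>L\<in>replicas D. \<Sum>y\<in>?Y. (?t y M * ?c y L) * ?p M L)"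
    by (rule sum.cong[OF refl], rule sum.swap)
  also have "\<dots> = (\<Sum>M\<in>replicas D. \<Sum>L\<in>replicas D. (\<Prod>v\<in>Vp. of_bool (matching v (boundary_perm v) L M)) * ?p M L)"
    unfolding sum_distrib_right[symmetric]
    by (intro sum.cong refl arg_cong2[where f = "(*)"] sum_boundary_labels)
  finally show ?thesis .
qed

section \<open>Spin configurations and factorisation over edges\<close>

text \<open>The boundary spins are encoded as singleton choices, so that a product of sums over all
  of V expands uniformly.\<close>

definition assignments :: "('v \<Rightarrow> nat list) set" where
  "assignments = PiE V (\<lambda>v. if v \<in> Vb then perms4 else {boundary_perm v})"

text \<open>A maximally entangled edge has a single label per replica, shared by its two half-edges;
  hence both endpoint spins constrain the same pair (l, m).\<close>

definition edge_count :: "nat \<Rightarrow> ('v \<Rightarrow> nat list) \<Rightarrow> 'e \<Rightarrow> nat" where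
  "edge_count D q e = card {(l, m) \<in> ({..<4} \<rightarrow>\<^sub>E {..<D}) \<times> ({..<4} \<rightarrow>\<^sub>E {..<D}).
     \<forall>v\<in>ends e. \<forall>k<4. m k = l (q v ! k)}"

lemma assignments_in_perms4:
  assumes "q \<in> assignments" "v \<in> V"
  shows "q v \<in> perms4"
  using PiE_mem[OF assms[unfolded assignments_def]] boundary_perm_in_perms4[of v]
  by (cases "v \<in> Vb") simp_all

lemma finite_assignments: "finite assignments"
  unfolding assignments_def by (intro finite_PiE finite_V) auto

text \<open>Independence of the bulk vectors splits the expectation, and at each vertex the
  four-point function counts exactly the spins that glue M to L there.\<close>

lemma integral_bulk_measure:
  assumes "D > 0" and L: "L \<in> replicas D" and M: "M \<in> replicas D"
  shows "has_bochner_integral (bulk_measure E ends D Vb)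
     (\<lambda>psi. \<Prod>v\<in>Vb. (\<Prod>k<4. psi v (local_label (M k) v)) * (\<Prod>k<4. cnj (psi v (local_label (L k) v))))
     (\<Prod>v\<in>Vb. complex_of_real (card {p \<in> perms4. matching v p L M} / fixed_point_sum (labels E ends D v)))"
proof -
  interpret product_prob_space "\<lambda>v. haar_sphere (labels E ends D v)" Vb
    by (intro product_prob_spaceI prob_space_haar_sphere)
  have in_labels: "local_label (L k) v \<in> labels E ends D v" "local_label (M k) v \<in> labels E ends D v" if "k < 4" for k v
    using L M that by (auto intro!: at_in_labels)
  let ?f = "\<lambda>v \<psi>. (\<Prod>k<4. \<psi> (local_label (M k) v)) * (\<Prod>k<4. cnj (\<psi> (local_label (L k) v)))"
  have f: "integrable (haar_sphere (labels E ends D v)) (?f v)"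
    "integral\<^sup>L (haar_sphere (labels E ends D v)) (?f v) =
       complex_of_real (card {p \<in> perms4. matching v p L M} / fixed_point_sum (labels E ends D v))" for v
    unfolding matching_def
    by (intro integrable_haar_four_point haar_four_point finite_labels labels_nonempty assms(1) in_labels; assumption)+
  show ?thesis
    unfolding has_bochner_integral_iff bulk_measure_def f(2)[symmetric]
    by (intro conjI product_integrable_prod product_integral_prod finite_sets f(1))
qed

text \<open>A gluing condition at v speaks about each incident edge separately. Reading the arrays
  edge by edge instead of replica by replica therefore decouples the edges; \<open>?F\<close> is
  this transposition and \<open>?G\<close> its inverse, restricted to keep both sides
  extensional.\<close>

lemma card_matching_replicas:
  assumes "q \<in> assignments"
  shows "card {(L, M) \<in> replicas D \<times> replicas D. \<forall>v\<in>V. matching v (q v) L M} = (\<Prod>e\<in>E. edge_count D q e)"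
proof -
  let ?N = "{..<4::nat} \<rightarrow>\<^sub>E {..<D}"
  let ?S = "{(L, M) \<in> replicas D \<times> replicas D. \<forall>v\<in>V. matching v (q v) L M}"
  let ?Q = "\<lambda>e. {(l, m) \<in> ?N \<times> ?N. \<forall>v\<in>ends e. \<forall>k<4. m k = l (q v ! k)}"
  let ?F = "\<lambda>(L, M). \<lambda>e\<in>E. (\<lambda>k\<in>{..<4::nat}. L k e :: nat, \<lambda>k\<in>{..<4::nat}. M k e :: nat)"
  let ?G = "\<lambda>h. (\<lambda>k\<in>{..<4::nat}. \<lambda>e\<in>E. fst (h e) k :: nat, \<lambda>k\<in>{..<4::nat}. \<lambda>e\<in>E. snd (h e) k :: nat)"
  have lt: "q v ! k < 4" if "v \<in> V" "k < 4" for v k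
    using perms4_D(3)[OF assignments_in_perms4[OF assms that(1)] that(2)] .
  have at_eq: "local_label l v = local_label m v \<longleftrightarrow> (\<forall>e\<in>E. v \<in> ends e \<longrightarrow> l e = m e)" for l m :: "'e \<Rightarrow> nat" and v
    by (auto simp: fun_eq_iff restrict_def incident_def)
  have "bij_betw ?F ?S (PiE E ?Q)"
  proof (rule bij_betw_byWitness[where f' = ?G])
    show "\<forall>s\<in>?S. ?G (?F s) = s"
    proof
      fix s assume "s \<in> ?S"
      then obtain L M where s: "s = (L, M)" and "L \<in> replicas D" "M \<in> replicas D" by blast
      then have "(\<lambda>k\<in>{..<4}. \<lambda>e\<in>E. L k e) = L" "(\<lambda>k\<in>{..<4}. \<lambda>e\<in>E. M k e) = M"
        by (auto simp: fun_eq_iff PiE_iff extensional_def restrict_def)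
      then show "?G (?F s) = s"
        unfolding s by (simp cong: restrict_cong)
    qed
    show "\<forall>h\<in>PiE E ?Q. ?F (?G h) = h"
    proof
      fix h assume h: "h \<in> PiE E ?Q"
      have "(\<lambda>k\<in>{..<4}. fst (h e) k, \<lambda>k\<in>{..<4}. snd (h e) k) = h e" if "e \<in> E" for e
      proof -
        have "h e \<in> ?N \<times> ?N" using h that by (auto simp: PiE_iff)
        then show ?thesis by (cases "h e") (auto simp: fun_eq_iff PiE_iff extensional_def restrict_def)
      qed
      then show "?F (?G h) = h"
        using h by (auto simp: fun_eq_iff PiE_iff extensional_def restrict_def)
    qed
    show "?F ` ?S \<subseteq> PiE E ?Q"
    proof
      fix h assume "h \<in> ?F ` ?S"
      then obtain L M where h: "h = ?F (L, M)"
        and LM: "L \<in> replicas D" "M \<in> replicas D" "\<forall>v\<in>V. matching v (q v) L M" by blast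
      have "M k e = L (q v ! k) e" if "e \<in> E" "v \<in> ends e" "k < 4" for e v k
        using LM(3) ends(1)[OF that(1)] that unfolding matching_def at_eq by blast
      moreover have "q v ! k < 4" if "e \<in> E" "v \<in> ends e" "k < 4" for e v k
        using lt ends(1) that by blast
      ultimately show "h \<in> PiE E ?Q"
        using LM(1,2) unfolding h by (auto simp: PiE_iff)
    qed
    show "?G ` PiE E ?Q \<subseteq> ?S"
    proof
      fix s assume "s \<in> ?G ` PiE E ?Q"
      then obtain h where h: "h \<in> PiE E ?Q" and s: "s = ?G h" by blast
      have N: "fst (h e) \<in> ?N" "snd (h e) \<in> ?N"
        and Q: "\<And>v k. v \<in> ends e \<Longrightarrow> k < 4 \<Longrightarrow> snd (h e) k = fst (h e) (q v ! k)" if "e \<in> E" for e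
        using PiE_mem[OF h that] by auto
      have "(\<lambda>k\<in>{..<4}. \<lambda>e\<in>E. fst (h e) k) \<in> replicas D" "(\<lambda>k\<in>{..<4}. \<lambda>e\<in>E. snd (h e) k) \<in> replicas D"
        using N by (auto simp: PiE_iff)
      moreover have "matching v (q v) (\<lambda>k\<in>{..<4}. \<lambda>e\<in>E. fst (h e) k) (\<lambda>k\<in>{..<4}. \<lambda>e\<in>E. snd (h e) k)" if "v \<in> V" for v
        unfolding matching_def at_eq using lt[OF that] Q by simp
      ultimately show "s \<in> ?S" unfolding s by simp
    qed
  qed
  then have "card ?S = card (PiE E ?Q)" by (rule bij_betw_same_card)
  then show ?thesis
    using finite_E by (simp add: card_PiE edge_count_def)
qed

text \<open>The exact partition function at finite D. The normalisation separates the Haar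
  prefactor, which tends to 1 when the local dimensions grow, from edge weights that are at most
  1.\<close>

lemma expected_swap_eq:
  assumes "D > 0"
  shows "expected_swap E ends Vb A B C D = complex_of_real (
     (\<Prod>v\<in>Vb. real (card (labels E ends D v)) ^ 4 / fixed_point_sum (labels E ends D v)) *
     (\<Sum>q\<in>assignments. \<Prod>e\<in>E. edge_count D q e / real D ^ 4))"
proof -
  let ?m = "\<lambda>v p L M. of_bool (matching v p L M) :: complex"
  let ?S = "\<lambda>v. fixed_point_sum (labels E ends D v)"
  let ?P = "\<lambda>v. if v \<in> Vb then perms4 else {boundary_perm v}"
  have "expected_swap E ends Vb A B C D =
    (\<Sum>M\<in>replicas D. \<Sum>L\<in>replicas D. (\<Prod>v\<in>Vp. ?m v (boundary_perm v) L M) *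
       ((replica_weight D)\<^sup>2 *
       (\<Prod>v\<in>Vb. complex_of_real (card {p \<in> perms4. matching v p L M} / ?S v))))"
    unfolding expected_swap_def swap_moment_expand
    by (intro has_bochner_integral_integral_eq has_bochner_integral_sum has_bochner_integral_mult_right
        integral_bulk_measure assms) auto
  also have "\<dots> = (\<Sum>M\<in>replicas D. \<Sum>L\<in>replicas D. (replica_weight D)\<^sup>2 * (\<Prod>v\<in>Vb. 1 / of_nat (?S v)) *
      (\<Sum>q\<in>assignments. of_bool (\<forall>v\<in>V. matching v (q v) L M)))"
  proof (intro sum.cong refl)
    fix M L
    \<comment> \<open>The count of gluing spins at a vertex is a sum of indicators; multiplying out
      over the vertices produces the sum over configurations.\<close>
    have "(\<Sum>q\<in>assignments. of_bool (\<forall>v\<in>V. matching v (q v) L M)) = (\<Sum>q\<in>assignments. \<Prod>v\<in>V. ?m v (q v) L M)"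
      by (simp add: prod_of_bool finite_V)
    also have "\<dots> = (\<Prod>v\<in>V. \<Sum>p\<in>?P v. ?m v p L M)"
      unfolding assignments_def by (rule prod_sum_PiE[symmetric]) (auto simp: finite_V)
    also have "\<dots> = (\<Prod>v\<in>Vp. \<Sum>p\<in>?P v. ?m v p L M) * (\<Prod>v\<in>Vb. \<Sum>p\<in>?P v. ?m v p L M)"
      unfolding V_eq by (intro prod.union_disjoint finite_sets disj)
    also have "(\<Prod>v\<in>Vp. \<Sum>p\<in>?P v. ?m v p L M) = (\<Prod>v\<in>Vp. ?m v (boundary_perm v) L M)"
      using disj by (intro prod.cong refl) auto
    also have "(\<Prod>v\<in>Vb. \<Sum>p\<in>?P v. ?m v p L M) = (\<Prod>v\<in>Vb. of_nat (card {p \<in> perms4. matching v p L M}))"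
      by (intro prod.cong refl) (simp add: Int_def)
    finally show "(\<Prod>v\<in>Vp. ?m v (boundary_perm v) L M) * ((replica_weight D)\<^sup>2 *
       (\<Prod>v\<in>Vb. complex_of_real (card {p \<in> perms4. matching v p L M} / ?S v)))
      = (replica_weight D)\<^sup>2 * (\<Prod>v\<in>Vb. 1 / of_nat (?S v)) *
      (\<Sum>q\<in>assignments. of_bool (\<forall>v\<in>V. matching v (q v) L M))"
      by (simp add: prod_dividef)
  qed
  also have "\<dots> = (replica_weight D)\<^sup>2 * (\<Prod>v\<in>Vb. 1 / of_nat (?S v)) *
     (\<Sum>(M, L)\<in>replicas D \<times> replicas D. \<Sum>q\<in>assignments. of_bool (\<forall>v\<in>V. matching v (q v) L M))"
    by (simp only: sum.cartesian_product[symmetric] sum_distrib_left[symmetric])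
  also have "(\<Sum>(M, L)\<in>replicas D \<times> replicas D. \<Sum>q\<in>assignments. of_bool (\<forall>v\<in>V. matching v (q v) L M))
     = (\<Sum>q\<in>assignments. \<Sum>(M, L)\<in>replicas D \<times> replicas D. of_bool (\<forall>v\<in>V. matching v (q v) L M) :: complex)"
    unfolding case_prod_beta by (rule sum.swap)
  also have "\<dots> = (\<Sum>q\<in>assignments. of_nat (\<Prod>e\<in>E. edge_count D q e))"
  proof (rule sum.cong[OF refl])
    fix q assume q: "q \<in> assignments"
    have "(\<Sum>(M, L)\<in>replicas D \<times> replicas D. of_bool (\<forall>v\<in>V. matching v (q v) L M) :: complex)
      = (\<Sum>(L, M)\<in>replicas D \<times> replicas D. of_bool (\<forall>v\<in>V. matching v (q v) L M))"
      unfolding sum.cartesian_product[symmetric] by (rule sum.swap)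
    also have "\<dots> = of_nat (card {(L, M) \<in> replicas D \<times> replicas D. \<forall>v\<in>V. matching v (q v) L M})"
      using finite_edge_labels(2)[of D]
      by (auto simp: case_prod_beta Int_def intro!: arg_cong[where f = card])
    finally show "(\<Sum>(M, L)\<in>replicas D \<times> replicas D. of_bool (\<forall>v\<in>V. matching v (q v) L M) :: complex)
      = of_nat (\<Prod>e\<in>E. edge_count D q e)"
      unfolding card_matching_replicas[OF q] .
  qed
  \<comment> \<open>The squared weight supplies the fourth power of the local dimension
    \<open>D ^ deg\<close> at every bulk vertex and D^(-4) on every edge.\<close>
  also have "(replica_weight D)\<^sup>2 * (\<Prod>v\<in>Vb. 1 / of_nat (?S v)) * (\<Sum>q\<in>assignments. of_nat (\<Prod>e\<in>E. edge_count D q e))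
     = complex_of_real ((\<Prod>v\<in>Vb. real (card (labels E ends D v)) ^ 4 / ?S v) *
        (\<Sum>q\<in>assignments. \<Prod>e\<in>E. edge_count D q e / real D ^ 4))"
  proof -
    have 1: "real (card (labels E ends D v)) ^ 4 = real D ^ (4 * deg E ends v)" for v
      by (simp add: card_labels power_mult[symmetric] mult.commute)
    have 2: "(\<Sum>q\<in>assignments. \<Prod>e\<in>E. edge_count D q e / real D ^ 4)
        = (\<Sum>q\<in>assignments. \<Prod>e\<in>E. real (edge_count D q e)) / real D ^ (4 * card E)"
      by (simp add: prod_dividef sum_divide_distrib power_mult)
    show ?thesis
      unfolding replica_weight_square[OF assms] 2 unfolding 1 prod_dividef by simp
  qed
  finally show ?thesis .
qed

text \<open>The spin at v determines m from l; the spin at w then demands that both readings of l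
  coincide.\<close>

lemma edge_count_eq:
  assumes "q \<in> assignments" "e \<in> E" "ends e = {v, w}"
  shows "edge_count D q e = card (agreeing {..<D} (q v) (q w))"
proof -
  let ?N = "{..<4::nat} \<rightarrow>\<^sub>E {..<D}"
  let ?Q = "{(l, m) \<in> ?N \<times> ?N. \<forall>u\<in>ends e. \<forall>k<4. m k = l (q u ! k)}"
  have "v \<in> V" using assms ends(1) by auto
  then have lt: "q v ! k < 4" if "k < 4" for k
    using perms4_D(3)[OF assignments_in_perms4[OF assms(1)] that] by blast
  have "bij_betw fst ?Q (agreeing {..<D} (q v) (q w))"
  proof (rule bij_betw_byWitness[where f' = "\<lambda>l. (l, \<lambda>k\<in>{..<4}. l (q v ! k))"])
    show "\<forall>s\<in>?Q. (fst s, \<lambda>k\<in>{..<4}. fst s (q v ! k)) = s"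
    proof
      fix s assume s: "s \<in> ?Q"
      then obtain l m where lm: "s = (l, m)" "m \<in> ?N" by blast
      have "(\<lambda>k\<in>{..<4}. l (q v ! k)) = m"
        using s lm assms(3) by (intro extensionalityI[of _ "{..<4}"]) (auto simp: PiE_iff)
      then show "(fst s, \<lambda>k\<in>{..<4}. fst s (q v ! k)) = s" using lm by simp
    qed
    show "\<forall>l\<in>agreeing {..<D} (q v) (q w). fst (l, \<lambda>k\<in>{..<4}. l (q v ! k)) = l" by simp
    show "fst ` ?Q \<subseteq> agreeing {..<D} (q v) (q w)"
      using assms(3) by (auto simp: agreeing_def)
    show "(\<lambda>l. (l, \<lambda>k\<in>{..<4}. l (q v ! k))) ` agreeing {..<D} (q v) (q w) \<subseteq> ?Q"
    proof
      fix s assume "s \<in> (\<lambda>l. (l, \<lambda>k\<in>{..<4}. l (q v ! k))) ` agreeing {..<D} (q v) (q w)"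
      then obtain l where s: "s = (l, \<lambda>k\<in>{..<4}. l (q v ! k))" and l: "l \<in> agreeing {..<D} (q v) (q w)" by blast
      have lN: "l \<in> ?N" and eq: "l (q v ! k) = l (q w ! k)" if "k < 4" for k
        using l that by (auto simp: agreeing_def)
      have "(\<lambda>k\<in>{..<4}. l (q v ! k)) \<in> ?N"
        using lN[of 0] lt by (auto simp: PiE_iff)
      then show "s \<in> ?Q"
        unfolding s using lN[of 0] eq assms(3) by simp
    qed
  qed
  then show ?thesis
    unfolding edge_count_def by (rule bij_betw_same_card)
qed

section \<open>Cuts obtained from the two colourings\<close>

definition colour_parts :: "(nat list \<Rightarrow> nat) \<Rightarrow> ('v \<Rightarrow> nat list) \<Rightarrow> 'v set \<times> 'v set \<times> 'v set" where
  "colour_parts c q = ({v\<in>V. c (q v) = 1}, {v\<in>V. c (q v) = 2}, {v\<in>V. c (q v) = 3})"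

lemma assignments_boundary:
  assumes "q \<in> assignments" "v \<in> Vp"
  shows "q v = boundary_perm v"
proof -
  have "v \<in> V" "v \<notin> Vb" using assms(2) V_eq disj by auto
  then show ?thesis using PiE_mem[OF assms(1)[unfolded assignments_def], of v] by simp
qed

lemma colour_range: "colour0 p \<in> {1,2,3}" "colour1 p \<in> {1,2,3}"
  by (auto simp: colour0_def colour1_def)

lemma colour_boundary_perms:
  "c \<in> {colour0, colour1} \<Longrightarrow> c [1,0,3,2] = 1"
  "c \<in> {colour0, colour1} \<Longrightarrow> c [2,3,0,1] = 2"
  "c \<in> {colour0, colour1} \<Longrightarrow> c [3,2,1,0] = 3"
  by (auto simp: colour0_def colour1_def)

text \<open>Both colourings give the boundary spins of A, B, C the values 1, 2, 3, which is the
  boundary condition of a tripartition.\<close>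

lemma colour_parts_tripartition:
  assumes "q \<in> assignments" and c: "c \<in> {colour0, colour1}"
  shows "is_tripartition V Vp A B C (colour_parts c q)"
proof -
  have range: "c p = 1 \<or> c p = 2 \<or> c p = 3" for p
    using c colour_range[of p] by auto
  have A: "c (q v) = 1" if "v \<in> A" for v
    using assignments_boundary[OF assms(1)] that colour_boundary_perms[OF c] by (simp add: boundary_perm_def)
  have B: "c (q v) = 2" if "v \<in> B" for v
    using assignments_boundary[OF assms(1)] that colour_boundary_perms[OF c] ABC_disj
    by (auto simp: boundary_perm_def)
  have C: "c (q v) = 3" if "v \<in> C" for v
    using assignments_boundary[OF assms(1)] that colour_boundary_perms[OF c] ABC_disj
    by (auto simp: boundary_perm_def)
  have "V \<subseteq> {v\<in>V. c (q v) = 1} \<union> {v\<in>V. c (q v) = 2} \<union> {v\<in>V. c (q v) = 3}"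
    using range by blast
  moreover have "Vp \<subseteq> V" using V_eq by blast
  ultimately show ?thesis
    unfolding is_tripartition_def colour_parts_def split
    using A B C by (intro conjI equalityI subsetI) auto
qed

lemma in_cut_colour_parts:
  assumes "e \<in> E" "ends e = {v, w}" and c: "c \<in> {colour0, colour1}"
  shows "e \<in> cut_edges E ends (colour_parts c q) \<longleftrightarrow> c (q v) \<noteq> c (q w)"
proof -
  have "c p = 1 \<or> c p = 2 \<or> c p = 3" for p
    using c colour_range[of p] by auto
  moreover have "v \<in> V" "w \<in> V" using ends(1)[OF assms(1)] assms(2) by auto
  ultimately show ?thesis
    using assms(1,2) unfolding cut_edges_def colour_parts_def by simp metis
qed

lemma ends_eq_pair: "e \<in> E \<Longrightarrow> \<exists>v w. ends e = {v, w}"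
  using ends(2) by (metis card_2_iff)

text \<open>At an edge \<open>colour_dist\<close> counts how many of the two cuts contain it, so the
  exponents add up to the two cut sizes.\<close>

lemma prod_edge_count_le:
  assumes q: "q \<in> assignments" and D: "D > 0"
  shows "(\<Prod>e\<in>E. edge_count D q e / real D ^ 4)
    \<le> 1 / real D ^ (card (cut_edges E ends (colour_parts colour0 q)) + card (cut_edges E ends (colour_parts colour1 q)))"
proof -
  let ?c0 = "cut_edges E ends (colour_parts colour0 q)"
  let ?c1 = "cut_edges E ends (colour_parts colour1 q)"
  let ?d = "\<lambda>e. of_bool (e \<in> ?c0) + of_bool (e \<in> ?c1) :: nat"
  have "(\<Prod>e\<in>E. edge_count D q e / real D ^ 4) \<le> (\<Prod>e\<in>E. 1 / real D ^ ?d e)"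
  proof (intro prod_mono conjI)
    fix e assume e: "e \<in> E"
    then obtain v w where vw: "ends e = {v, w}" using ends_eq_pair by blast
    have vwV: "v \<in> V" "w \<in> V" using ends(1)[OF e] vw by auto
    have "colour_dist (q v) (q w) = ?d e"
      using in_cut_colour_parts[OF e vw] by (simp add: colour_dist_def)
    then have "edge_count D q e * D ^ ?d e \<le> D ^ 4"
      using card_agreeing_colour_dist[of "{..<D}" "q v" "q w"] assignments_in_perms4[OF q] vwV
      by (simp add: edge_count_eq[OF q e vw])
    then have "real (edge_count D q e) * real D ^ ?d e \<le> real D ^ 4"
      by (metis of_nat_le_iff of_nat_mult of_nat_power)
    then show "edge_count D q e / real D ^ 4 \<le> 1 / real D ^ ?d e"
      using D by (simp add: divide_simps del: power_add)
  qed simp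
  also have "\<dots> = 1 / real D ^ (\<Sum>e\<in>E. ?d e)"
    by (simp only: prod_dividef prod.neutral_const power_sum)
  also have "(\<Sum>e\<in>E. ?d e) = card ?c0 + card ?c1"
  proof -
    have "E \<inter> cut_edges E ends t = cut_edges E ends t" for t by (auto simp: cut_edges_def)
    then have "(\<Sum>e\<in>E. of_bool (e \<in> cut_edges E ends t)) = card (cut_edges E ends t)" for t
      using finite_E by simp
    then show ?thesis by (simp only: sum.distrib)
  qed
  finally show ?thesis .
qed

text \<open>Moving an isolated bulk vertex to another part costs nothing. Uniqueness of the minimum
  therefore forces positive degree on bulk vertices; at degree 0 the local dimension would be 1 and
  the Haar factor would stay at 1/24 for every D.\<close>

lemma swapped_vertex_tripartition:
  assumes t: "is_tripartition V Vp A B C (GA, GB, GC)" and v: "v \<in> Vb" "incident E ends v = {}"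
  shows "\<exists>t. t \<noteq> (GA, GB, GC) \<and> is_tripartition V Vp A B C t
     \<and> cut_edges E ends t = cut_edges E ends (GA, GB, GC)"
proof -
  have ne: "v \<notin> ends e" if "e \<in> E" for e using v(2) that by (auto simp: incident_def)
  have vV: "v \<in> V" "v \<notin> Vp" using v(1) V_eq disj by auto
  have sub: "ends e \<subseteq> insert v X \<longleftrightarrow> ends e \<subseteq> X" "ends e \<subseteq> X - {v} \<longleftrightarrow> ends e \<subseteq> X" if "e \<in> E" for e X
    using ne[OF that] by blast+
  have tri: "GA \<union> GB \<union> GC = V" "GA \<inter> GB = {}" "GA \<inter> GC = {}" "GB \<inter> GC = {}"
      "Vp \<inter> GA = A" "Vp \<inter> GB = B" "Vp \<inter> GC = C"
    using t by (simp_all add: is_tripartition_def)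
  show ?thesis
  \<comment> \<open>The target is always a part not containing v, which makes the new triple differ
    from the old one.\<close>
  proof (cases "v \<in> GB")
    case False
    have "(GA - {v}) \<union> insert v GB \<union> (GC - {v}) = V" using tri(1) vV(1) by blast
    moreover have "(GA - {v}) \<inter> insert v GB = {}" using tri(2) by blast
    moreover have "(GA - {v}) \<inter> (GC - {v}) = {}" using tri(3) by blast
    moreover have "insert v GB \<inter> (GC - {v}) = {}" using tri(4) by blast
    moreover have "Vp \<inter> (GA - {v}) = A" using tri(5) vV(2) by blast
    moreover have "Vp \<inter> insert v GB = B" using tri(6) vV(2) by blast
    moreover have "Vp \<inter> (GC - {v}) = C" using tri(7) vV(2) by blast
    ultimately have 1: "is_tripartition V Vp A B C (GA - {v}, insert v GB, GC - {v})"
      unfolding is_tripartition_def split by (intro conjI)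
    have 2: "cut_edges E ends (GA - {v}, insert v GB, GC - {v}) = cut_edges E ends (GA, GB, GC)"
      unfolding cut_edges_def split by (intro Collect_cong conj_cong refl) (simp only: sub)
    have 3: "(GA - {v}, insert v GB, GC - {v}) \<noteq> (GA, GB, GC)" using False by auto
    show ?thesis by (intro exI conjI) (rule 3, rule 1, rule 2)
  next
    case True
    have "insert v GA \<union> (GB - {v}) \<union> GC = V" using tri(1) vV(1) by blast
    moreover have "insert v GA \<inter> (GB - {v}) = {}" using tri(2) by blast
    moreover have "insert v GA \<inter> GC = {}" using tri(3,4) True by blast
    moreover have "(GB - {v}) \<inter> GC = {}" using tri(4) by blast
    moreover have "Vp \<inter> insert v GA = A" using tri(5) vV(2) by blast
    moreover have "Vp \<inter> (GB - {v}) = B" using tri(6) vV(2) by blast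
    ultimately have 1: "is_tripartition V Vp A B C (insert v GA, GB - {v}, GC)"
      unfolding is_tripartition_def split using tri(7) by (intro conjI)
    have 2: "cut_edges E ends (insert v GA, GB - {v}, GC) = cut_edges E ends (GA, GB, GC)"
      unfolding cut_edges_def split by (intro Collect_cong conj_cong refl) (simp only: sub)
    have 3: "(insert v GA, GB - {v}, GC) \<noteq> (GA, GB, GC)" using True by auto
    show ?thesis by (intro exI conjI) (rule 3, rule 1, rule 2)
  qed
qed

section \<open>Asymptotics in the bond dimension\<close>

text \<open>Positive degree makes every local dimension at least D, so each factor is within 23/D of
  1, with one unit for each permutation other than the identity.\<close>

lemma haar_prefactor_bounds:
  assumes D: "D > 0" and deg: "\<And>v. v \<in> Vb \<Longrightarrow> deg E ends v \<ge> 1"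
  defines "P \<equiv> \<Prod>v\<in>Vb. real (card (labels E ends D v)) ^ 4 / fixed_point_sum (labels E ends D v)"
  shows "P \<le> 1" "P \<ge> 1 - 23 * real (card Vb) / real D" "P \<ge> 0"
proof -
  let ?c = "\<lambda>v. real (card (labels E ends D v)) ^ 4 / fixed_point_sum (labels E ends D v)"
  have c: "0 \<le> ?c v \<and> ?c v \<le> 1 \<and> 1 - ?c v \<le> 23 / real D" if v: "v \<in> Vb" for v
  proof -
    define d where "d = card (labels E ends D v)"
    define S where "S = fixed_point_sum (labels E ends D v)"
    have "D ^ 1 \<le> D ^ deg E ends v" using deg[OF v] D by (intro power_increasing) auto
    then have d: "D \<le> d" by (simp add: d_def card_labels)
    have S: "d ^ 4 \<le> S" "S \<le> d ^ 4 + 23 * d ^ 3"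
      using fixed_point_sum_bounds[OF finite_labels] by (auto simp: d_def S_def)
    have Sr: "real d ^ 4 \<le> S" "S \<le> real d ^ 4 + 23 * real d ^ 3"
      using of_nat_mono[OF S(1), where 'a = real] of_nat_mono[OF S(2), where 'a = real] by simp_all
    have dpos: "real d > 0" "real d ^ 4 > 0" using d D by auto
    then have Spos: "real S > 0" using Sr by linarith
    have "1 - real d ^ 4 / S = (S - real d ^ 4) / S" using Spos by (simp add: diff_divide_distrib)
    also have "\<dots> \<le> 23 * real d ^ 3 / real d ^ 4"
      using Sr dpos by (intro frac_le) auto
    also have "\<dots> = 23 / real d" using dpos by (simp add: field_simps power_numeral_reduce)
    also have "\<dots> \<le> 23 / real D" using d D by (intro frac_le) auto
    finally have "1 - real d ^ 4 / S \<le> 23 / real D" .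
    then show ?thesis using Sr Spos by (simp add: d_def[symmetric] S_def[symmetric])
  qed
  show "P \<le> 1" "P \<ge> 0" unfolding P_def using c by (auto intro!: prod_le_1 prod_nonneg)
  \<comment> \<open>The Weierstrass product inequality lets the defects of the factors add
    up.\<close>
  have "1 - (\<Sum>v\<in>Vb. 1 - ?c v) \<le> (\<Prod>v\<in>Vb. 1 - (1 - ?c v))"
    using c by (intro Weierstrass_prod_ineq) auto
  moreover have "(\<Sum>v\<in>Vb. 1 - ?c v) \<le> of_nat (card Vb) * (23 / real D)"
    using c by (intro sum_bounded_above) auto
  ultimately show "P \<ge> 1 - 23 * real (card Vb) / real D" by (simp add: P_def)
qed

text \<open>After rescaling, one configuration has weight exactly 1 and each of the others at most
  1/D.\<close>

lemma assignment_sum_bounds: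
  assumes D: "D > 0"
    and min: "is_min_tripartition V E ends Vp A B C (GA, GB, GC)"
    and unique: "\<And>t. is_min_tripartition V E ends Vp A B C t \<Longrightarrow> t = (GA, GB, GC)"
  defines "S \<equiv> (\<Sum>q\<in>assignments. \<Prod>e\<in>E. edge_count D q e / real D ^ 4)
      * real D ^ (2 * card (cut_edges E ends (GA, GB, GC)))"
  shows "1 \<le> S" "S \<le> 1 + card assignments / real D"
proof -
  let ?g = "card (cut_edges E ends (GA, GB, GC))"
  let ?w = "\<lambda>q. (\<Prod>e\<in>E. edge_count D q e / real D ^ 4) * real D ^ (2 * ?g)"
  have tri: "GA \<union> GB \<union> GC = V" "GA \<inter> GB = {}" "GA \<inter> GC = {}" "GB \<inter> GC = {}"
      "Vp \<inter> GA = A" "Vp \<inter> GB = B" "Vp \<inter> GC = C"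
    using min by (simp_all add: is_min_tripartition_def is_tripartition_def)
  \<comment> \<open>The configuration that extends the boundary spins constantly over the parts of
    the minimal tripartition.\<close>
  define r where "r = (\<lambda>v\<in>V. if v \<in> GA then [1,0,3,2] else if v \<in> GB then [2,3,0,1] else [3,2,1,0::nat])"
  have min_le: "?g \<le> card (cut_edges E ends t)" if "is_tripartition V Vp A B C t" for t
    using conjunct2[OF min[unfolded is_min_tripartition_def]] that by blast
  have r_cases: "r v \<in> {[1,0,3,2],[2,3,0,1],[3,2,1,0]}" if "v \<in> V" for v
    using that by (auto simp: r_def)
  have r: "r \<in> assignments"
    unfolding assignments_def
  proof (rule PiE_I)
    fix v assume v: "v \<in> V"
    show "r v \<in> (if v \<in> Vb then perms4 else {boundary_perm v})"
    proof (cases "v \<in> Vb")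
      case True
      then show ?thesis using r_cases[OF v] by (auto simp: perms4_eq)
    next
      case False
      then have "v \<in> Vp" using v V_eq by blast
      then have "r v = boundary_perm v"
        using v tri(5,6) by (auto simp: r_def boundary_perm_def)
      then show ?thesis using False by simp
    qed
  qed (simp add: r_def)
  have parts_r: "colour_parts c r = (GA, GB, GC)" if c: "c \<in> {colour0, colour1}" for c
    unfolding colour_parts_def using tri(1-4) colour_boundary_perms[OF c]
    by (auto simp: r_def split: if_splits)
  have w_le: "?w q \<le> real D ^ (2 * ?g) / real D ^
     (card (cut_edges E ends (colour_parts colour0 q)) + card (cut_edges E ends (colour_parts colour1 q)))" if "q \<in> assignments" for q
    using mult_right_mono[OF prod_edge_count_le[OF that D], of "real D ^ (2 * ?g)"] by simp
  have w_nonneg: "?w q \<ge> 0" for q by (auto intro!: mult_nonneg_nonneg prod_nonneg)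
  \<comment> \<open>For r the lower bound on the cost is attained: across a cut edge two distinct
    double transpositions leave two cycles, so at least D^2 of the D^4 label choices
    survive.\<close>
  have w_r_ge: "?w r \<ge> 1"
  proof -
    let ?cut = "cut_edges E ends (GA, GB, GC)"
    have "(\<Prod>e\<in>E. 1 / real D ^ (2 * of_bool (e \<in> ?cut))) \<le> (\<Prod>e\<in>E. edge_count D r e / real D ^ 4)"
    proof (intro prod_mono conjI)
      fix e assume e: "e \<in> E"
      then obtain v w where vw: "ends e = {v, w}" using ends_eq_pair by blast
      have vwV: "v \<in> V" "w \<in> V" using ends(1)[OF e] vw by auto
      note rv = r_cases[OF vwV(1)] and rw = r_cases[OF vwV(2)]
      show "1 / real D ^ (2 * of_bool (e \<in> ?cut)) \<le> edge_count D r e / real D ^ 4"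
      proof (cases "r v = r w")
        case True
        then have "e \<notin> ?cut"
          using in_cut_colour_parts[OF e vw, of colour0 r] parts_r[of colour0] by simp
        then show ?thesis
          using D True by (simp add: edge_count_eq[OF r e vw] card_agreeing_self)
      next
        case False
        then have "colour0 (r v) \<noteq> colour0 (r w)"
          using rv rw by (auto simp: colour0_def)
        then have "e \<in> ?cut"
          using in_cut_colour_parts[OF e vw, of colour0 r] parts_r[of colour0] by simp
        moreover have "D\<^sup>2 \<le> edge_count D r e"
          using card_agreeing_boundary[OF _ rv rw False, of "{..<D}"] by (simp add: edge_count_eq[OF r e vw])
        then have "(real D)\<^sup>2 \<le> edge_count D r e" by (metis of_nat_le_iff of_nat_power)
        then have "(real D)\<^sup>2 / real D ^ 4 \<le> edge_count D r e / real D ^ 4"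
          by (intro divide_right_mono) auto
        moreover have "(real D)\<^sup>2 / real D ^ 4 = 1 / (real D)\<^sup>2"
          using D by (simp add: field_simps power_numeral_reduce)
        ultimately show ?thesis by simp
      qed
    qed simp
    also have "(\<Prod>e\<in>E. 1 / real D ^ (2 * of_bool (e \<in> ?cut))) = 1 / real D ^ (\<Sum>e\<in>E. 2 * of_bool (e \<in> ?cut))"
      by (simp only: prod_dividef prod.neutral_const power_sum)
    also have "(\<Sum>e\<in>E. 2 * of_bool (e \<in> ?cut)) = 2 * ?g"
    proof -
      have "E \<inter> ?cut = ?cut" by (auto simp: cut_edges_def)
      then show ?thesis using finite_E by (simp add: sum_distrib_left[symmetric])
    qed
    finally show ?thesis using D by (simp add: field_simps)
  qed
  have w_r_le: "?w r \<le> 1"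
    using w_le[OF r] D by (simp add: parts_r mult_2)
  have w_other: "?w q \<le> 1 / real D" if q: "q \<in> assignments" "q \<noteq> r" for q
  proof -
    let ?c0 = "card (cut_edges E ends (colour_parts colour0 q))"
    let ?c1 = "card (cut_edges E ends (colour_parts colour1 q))"
    have ge: "?g \<le> ?c0" "?g \<le> ?c1"
      using colour_parts_tripartition[OF q(1)] by (auto intro!: min_le)
    \<comment> \<open>If both cuts were minimal, uniqueness would make both colour tripartitions
      equal to the given one. The colourings then agree at every vertex, so each spin is a boundary
      spin of the right part, and q is r.\<close>
    have "\<not> (?c0 = ?g \<and> ?c1 = ?g)"
    proof
      assume eq: "?c0 = ?g \<and> ?c1 = ?g"
      have parts: "colour_parts c q = (GA, GB, GC)" if "c \<in> {colour0, colour1}" for c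
      proof (rule unique)
        have card: "card (cut_edges E ends (colour_parts c q)) = ?g" using eq that by auto
        show "is_min_tripartition V E ends Vp A B C (colour_parts c q)"
          unfolding is_min_tripartition_def card
          by (intro conjI allI impI min_le colour_parts_tripartition q(1) that)
      qed
      have "q v = r v" if v: "v \<in> V" for v
      proof -
        have G: "v \<in> GA \<longleftrightarrow> c (q v) = 1" "v \<in> GB \<longleftrightarrow> c (q v) = 2" "v \<in> GC \<longleftrightarrow> c (q v) = 3"
          if "c \<in> {colour0, colour1}" for c
          using parts[OF that] v unfolding colour_parts_def by auto
        have "colour0 (q v) = colour1 (q v)"
          using G[of colour0] G[of colour1] colour_range[of "q v"] by auto
        then have "q v \<in> {[1,0,3,2],[2,3,0,1],[3,2,1,0]}"
          using colour_eq[rule_format, OF assignments_in_perms4[OF q(1) v]] by simp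
        then show ?thesis
          using G[of colour0] v colour_boundary_perms[of colour0] by (auto simp: r_def)
      qed
      then have "q = r"
        using q(1) r unfolding assignments_def by (intro PiE_ext[of q V _ r]) auto
      with q(2) show False by contradiction
    qed
    \<comment> \<open>Cut sizes are integers, so a cost above the minimum exceeds it by at least
      one; this is the origin of the relative error 1/D.\<close>
    then have "2 * ?g + 1 \<le> ?c0 + ?c1" using ge by linarith
    then have "real D ^ (2 * ?g + 1) \<le> real D ^ (?c0 + ?c1)"
      using D by (intro power_increasing) auto
    then have "real D ^ (2 * ?g) / real D ^ (?c0 + ?c1) \<le> real D ^ (2 * ?g) / real D ^ (2 * ?g + 1)"
      using D by (intro divide_left_mono) auto
    also have "\<dots> = 1 / real D" using D by simp
    finally show ?thesis using w_le[OF q(1)] by linarith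
  qed
  have S: "S = ?w r + (\<Sum>q\<in>assignments - {r}. ?w q)"
    unfolding S_def sum_distrib_right by (rule sum.remove[OF finite_assignments r])
  show "1 \<le> S" unfolding S using w_r_ge w_nonneg by (intro add_increasing2 sum_nonneg) auto
  have "(\<Sum>q\<in>assignments - {r}. ?w q) \<le> of_nat (card (assignments - {r})) * (1 / real D)"
    using w_other by (intro sum_bounded_above) auto
  also have "\<dots> \<le> card assignments * (1 / real D)"
    using finite_assignments by (intro mult_right_mono) (auto intro!: card_mono)
  finally show "S \<le> 1 + card assignments / real D" unfolding S using w_r_le by simp
qed

end

theorem theorem3p1:
  fixes V Vp Vb A B C GA GB GC :: "'v set"
    and E :: "'e set" and ends :: "'e \<Rightarrow> 'v set"
  assumes "finite V" and "finite E"
    and "\<forall>e\<in>E. ends e \<subseteq> V \<and> card (ends e) = 2"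
    and "V = Vp \<union> Vb" and "Vp \<inter> Vb = {}"
    and "Vp = A \<union> B \<union> C" and "A \<inter> B = {}" and "A \<inter> C = {}" and "B \<inter> C = {}"
    and "is_min_tripartition V E ends Vp A B C (GA, GB, GC)"
    and "\<forall>t. is_min_tripartition V E ends Vp A B C t \<longrightarrow> t = (GA, GB, GC)"
  shows "(\<lambda>D::nat. cmod (expected_swap E ends Vb A B C D
            * of_nat D ^ (2 * card (cut_edges E ends (GA, GB, GC))) - 1))
         \<in> O(\<lambda>D. 1 / real D)"
proof -
  interpret tripartite_network V Vb A B C E ends
    using assms(1-9) by unfold_locales auto
  have min: "is_min_tripartition V E ends (A \<union> B \<union> C) A B C (GA, GB, GC)"
    and unique: "\<And>t. is_min_tripartition V E ends (A \<union> B \<union> C) A B C t \<Longrightarrow> t = (GA, GB, GC)"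
    using assms(6,10,11) by blast+
  have deg: "deg E ends v \<ge> 1" if v: "v \<in> Vb" for v
  proof (rule ccontr)
    assume "\<not> deg E ends v \<ge> 1"
    then have "incident E ends v = {}" using finite_sets(3)[of v] by (simp add: deg_def not_less_eq_eq)
    with swapped_vertex_tripartition[OF conjunct1[OF min[unfolded is_min_tripartition_def]] v]
    obtain t where t: "t \<noteq> (GA, GB, GC)" "is_tripartition V (A \<union> B \<union> C) A B C t"
        "cut_edges E ends t = cut_edges E ends (GA, GB, GC)"
      by metis
    then have "is_min_tripartition V E ends (A \<union> B \<union> C) A B C t"
      using min unfolding is_min_tripartition_def by simp
    then show False using unique t(1) by blast
  qed
  \<comment> \<open>Both terms depend on the graph only: the Haar normalisation contributes 23 per
    bulk vertex, and the suppressed configurations contribute their number.\<close>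
  let ?K = "23 * real (card Vb) + real (card assignments)"
  show ?thesis
  proof (rule bigoI[where c = ?K], rule eventually_mono[OF eventually_gt_at_top[of 0]])
    fix D :: nat assume D: "0 < D"
    let ?g = "2 * card (cut_edges E ends (GA, GB, GC))"
    define P where "P = (\<Prod>v\<in>Vb. real (card (labels E ends D v)) ^ 4 / fixed_point_sum (labels E ends D v))"
    define S where "S = (\<Sum>q\<in>assignments. \<Prod>e\<in>E. edge_count D q e / real D ^ 4) * real D ^ ?g"
    have P: "P \<le> 1" "P \<ge> 1 - 23 * real (card Vb) / real D" "P \<ge> 0"
      unfolding P_def using haar_prefactor_bounds[OF D deg] by auto
    have S: "1 \<le> S" "S \<le> 1 + card assignments / real D"
      unfolding S_def using assignment_sum_bounds[OF D min unique] by auto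
    have "expected_swap E ends Vb A B C D * of_nat D ^ ?g - 1 = complex_of_real (P * S - 1)"
      unfolding expected_swap_eq[OF D] P_def S_def by simp
    then have "cmod (expected_swap E ends Vb A B C D * of_nat D ^ ?g - 1) = \<bar>P * S - 1\<bar>"
      by (simp only: norm_of_real)
    also have "\<dots> \<le> 23 * real (card Vb) / real D + card assignments / real D"
    proof -
      \<comment> \<open>The product lies between P and S, so its distance from 1 is controlled by
        one-sided errors of opposite sign.\<close>
      have "P * 1 \<le> P * S" "P * S \<le> 1 * S"
        using mult_left_mono[of 1 S P] mult_right_mono[of P 1 S] P S by auto
      moreover have "0 \<le> 23 * real (card Vb) / real D" "0 \<le> card assignments / real D" by auto
      ultimately show ?thesis using P S by linarith
    qed
    finally show "norm (cmod (expected_swap E ends Vb A B C D * of_nat D ^ ?g - 1)) \<le> ?K * norm (1 / real D)"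
      using D by (simp add: add_divide_distrib)
  qed
qed

end
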